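(* Let $t\in\mathbb{Z}_{\ge 0}$ and, in the setting described in the context, let $u_t = Kx_t$ be the LQG control and let $\hat{u}_t := \mathbb{E}\left[u_t \mid y_{0:t}, u_{0:t-1}\right]$. Then the stochastic optimization problem $$\underset{\hat{u}_t}{\text{minimize}}\quad \mathbb{E}\left[\lVert u_t-\hat{u}_t\rVert^2 \mid y_{0:t},u_{0:t-1}\right]\quad\text{subject to}\quad x_{t},y_t \text{ generated by the system below, and } u_t=Kx_t \text{ the LQG solution},$$ is equivalent to the deterministic optimization problem $$\min_{\alpha_{0:t}}\ \operatorname{tr}\left[z_t^\top \Sigma_0^- z_t+\alpha_t^\top R\,\alpha_t+\sum_{i=0}^{t-1}\left(z_i^\top Q z_i+\alpha_i^\top R\,\alpha_i\right)\right]$$ $$\text{subject to}\quad z_0=K^\top+C^\top\alpha_0,\qquad z_{i+1}=A^\top z_i+C^\top\alpha_{i+1}\quad (i=0,\dots,t-1),$$ where $\alpha_i\in\mathbb{R}^{m\times p}$ and $z_i\in\mathbb{R}^{n\times p}$; that is, the two problems have the same optimal value, and the minimizer $\hat{u}_t$ of the stochastic problem is given, in terms of the solution $(z_{0:t},\alpha_{0:t})$ of the deterministic problem, by $$\hat{u}_t=z_t^\top\hat{x}_0^-+\sum_{i=0}^{t-1}z_i^\top B\,u_{t-i-1}-\sum_{i=0}^{t}\alpha_i^\top y_{t-i}.$$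
   Context: System: for $t\in\mathbb{Z}_{\ge0}$, $$x_{t+1}=Ax_t+Bu_t+\xi_t,\qquad y_t=Cx_t+\omega_t,$$ with state $x_t\in\mathbb{R}^n$, input $u_t\in\mathbb{R}^p$, measurement $y_t\in\mathbb{R}^m$ ($m<n$), and real matrices $A,B,C$ of compatible sizes. This is the partially observable system (POMDP). The initial state $x_0$ is a random vector with mean $\hat{x}_0^-\in\mathbb{R}^n$ and covariance $\Sigma_0^-\succeq0$. For each $t$, the noises $\xi_t$ and $\omega_t$ are mean-zero, mutually independent and identically distributed Gaussian random vectors with covariances $Q\in\mathbb{R}^{n\times n}$ and $R\in\mathbb{R}^{m\times m}$ respectively. Notation: $y_{0:t}=\{y_0,\dots,y_t\}$ is the measurement history, $u_{0:t-1}=\{u_0,\dots,u_{t-1}\}$ are the inputs previously applied to the system (known at time $t$), and similarly $\alpha_{0:t}=\{\alpha_0,\dots,\alpha_t\}$, $z_{0:t}=\{z_0,\dots,z_t\}$. The state $x_t$ itself is not available. $\operatorname{tr}$ denotes the trace. LQG control: given $Q_c\in\mathbb{R}^{n\times n}$, $Q_c\succeq0$, and $R_c\in\mathbb{R}^{p\times p}$, $R_c\succ0$, the LQG problem is to minimize $\mathbb{E}\left[\sum_{i=0}^\infty x_i^\top Q_cx_i+u_i^\top R_cu_i\right]$. It is assumed that $(A,B)$ is stabilizable and $(A,\sqrt{Q_c})$ is detectable, where $\sqrt{Q_c}$ is the unique positive semidefinite square root of $Q_c$. The "LQG solution" (for perfectly measured state) is $u_t=Kx_t$ with the steady-state gain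 $$K=-(R_c+B^\top P_cB)^{-1}B^\top P_cA\in\mathbb{R}^{p\times n},$$ where $P_c$ is obtained by solving the discrete algebraic Riccati equation $$P_c=A^\top P_cA-A^\top P_cB(R_c+B^\top P_cB)^{-1}B^\top P_cA+Q_c.$$ In the claim, $u_t=Kx_t$ is the target quantity at the current time $t$, to be estimated from $y_{0:t}$ and $u_{0:t-1}$, while $u_0,\dots,u_{t-1}$ are the inputs actually applied at earlier times.
   Formalization: The initial state x_0 is additionally assumed Gaussian and independent of all noises (otherwise the conditional mean need not be affine in the measurements), and the applied inputs are taken to be causal: functions of past and present measurements and independent randomness. *)

theory Defs
  imports "HOL-Probability.Probability"
begin

definition psd :: "real^'n^'n \<Rightarrow> bool" where
  "psd S \<longleftrightarrow> transpose S = S \<and> (\<forall>v. 0 \<le> v \<bullet> (S *v v))"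

definition pd :: "real^'n^'n \<Rightarrow> bool" where
  "pd S \<longleftrightarrow> transpose S = S \<and> (\<forall>v. v \<noteq> 0 \<longrightarrow> 0 < v \<bullet> (S *v v))"

(* unspecified unless Q is positive semidefinite, when existence and uniqueness hold *)
definition psd_sqrt :: "real^'n^'n \<Rightarrow> real^'n^'n" where
  "psd_sqrt Q = (THE S. psd S \<and> S ** S = Q)"

(* the spectrum is taken over the complex numbers *)
definition schur_stable :: "real^'n^'n \<Rightarrow> bool" where
  "schur_stable A \<longleftrightarrow>
    (\<forall>(c::complex) v. v \<noteq> 0 \<and> map_matrix complex_of_real A *v v = c *s v \<longrightarrow> cmod c < 1)"

definition stabilizable :: "real^'n^'n \<Rightarrow> real^'p^'n \<Rightarrow> bool" where
  "stabilizable A B \<longleftrightarrow> (\<exists>F. schur_stable (A + B ** F))"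

definition detectable :: "real^'n^'n \<Rightarrow> real^'n^'m \<Rightarrow> bool" where
  "detectable A C \<longleftrightarrow> (\<exists>L. schur_stable (A + L ** C))"

definition dare :: "real^'n^'n \<Rightarrow> real^'p^'n \<Rightarrow> real^'n^'n \<Rightarrow> real^'p^'p \<Rightarrow> real^'n^'n \<Rightarrow> bool" where
  "dare A B Qc Rc P \<longleftrightarrow>
    P = transpose A ** P ** A
        - transpose A ** P ** B ** matrix_inv (Rc + transpose B ** P ** B) ** transpose B ** P ** A
        + Qc"

definition lqg_gain :: "real^'n^'n \<Rightarrow> real^'p^'n \<Rightarrow> real^'p^'p \<Rightarrow> real^'n^'n \<Rightarrow> real^'n^'p" where
  "lqg_gain A B Rc P = - (matrix_inv (Rc + transpose B ** P ** B) ** transpose B ** P ** A)"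

definition normal_law :: "real \<Rightarrow> real \<Rightarrow> real measure" where
  "normal_law m v =
    (if v = 0 then return borel m else density lborel (normal_density m (sqrt v)))"

(* Covariances may be singular, so a density on the whole space need not exist. *)
definition gaussian_vector ::
    "'a measure \<Rightarrow> ('a \<Rightarrow> real^'n) \<Rightarrow> real^'n \<Rightarrow> real^'n^'n \<Rightarrow> bool" where
  "gaussian_vector M X \<mu> S \<longleftrightarrow>
    X \<in> borel_measurable M \<and> psd S \<and>
    (\<forall>a. distr M borel (\<lambda>s. a \<bullet> X s) = normal_law (a \<bullet> \<mu>) (a \<bullet> (S *v a)))"

definition rv_events :: "'a measure \<Rightarrow> ('a \<Rightarrow> 'b::topological_space) \<Rightarrow> 'a set set" where
  "rv_events M X = {X -` A \<inter> space M |A. A \<in> sets borel}"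

(* The library constant indep_vars needs variables of one common type, whereas states and
   measurements have different dimensions; hence independence is stated with indep_sets for
   the generated sigma-algebras, which is also how indep_vars unfolds. *)
datatype source = Initial | Process nat | Measurement nat | Exogenous

fun source_events ::
    "'a measure \<Rightarrow> ('a \<Rightarrow> real^'n) \<Rightarrow> (nat \<Rightarrow> 'a \<Rightarrow> real^'n) \<Rightarrow> (nat \<Rightarrow> 'a \<Rightarrow> real^'m) \<Rightarrow>
     'a measure \<Rightarrow> source \<Rightarrow> 'a set set" where
  "source_events M x0 \<xi> w G Initial = rv_events M x0"
| "source_events M x0 \<xi> w G (Process i) = rv_events M (\<xi> i)"
| "source_events M x0 \<xi> w G (Measurement i) = rv_events M (w i)"
| "source_events M x0 \<xi> w G Exogenous = sets G"

definition info_algebra ::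
    "'a measure \<Rightarrow> (nat \<Rightarrow> 'a \<Rightarrow> real^'m) \<Rightarrow> (nat \<Rightarrow> 'a \<Rightarrow> real^'p) \<Rightarrow> nat \<Rightarrow> 'a measure" where
  "info_algebra M y u t =
    sigma (space M) ((\<Union>i\<in>{..t}. rv_events M (y i)) \<union> (\<Union>i\<in>{..<t}. rv_events M (u i)))"

(* Inputs are non-anticipative: u i is a function of y 0, ..., y i and of exogenous randomness G.
   Open-loop inputs and deterministic output feedback need only the trivial G. *)
definition causal_inputs ::
    "'a measure \<Rightarrow> 'a measure \<Rightarrow> (nat \<Rightarrow> 'a \<Rightarrow> real^'m) \<Rightarrow> (nat \<Rightarrow> 'a \<Rightarrow> real^'p) \<Rightarrow> bool" where
  "causal_inputs M G y u \<longleftrightarrow>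
    (\<forall>i. u i \<in> borel_measurable (sigma (space M) (sets G \<union> (\<Union>j\<in>{..i}. rv_events M (y j)))))"

definition vec_cond_exp ::
    "'a measure \<Rightarrow> 'a measure \<Rightarrow> ('a \<Rightarrow> real^'p) \<Rightarrow> 'a \<Rightarrow> real^'p" where
  "vec_cond_exp M F X = (\<lambda>s. \<chi> j. real_cond_exp M F (\<lambda>s'. X s' $ j) s)"

(* ennreal-valued, so that estimators need not be square integrable *)
definition cond_mse ::
    "'a measure \<Rightarrow> 'a measure \<Rightarrow> ('a \<Rightarrow> real^'p) \<Rightarrow> ('a \<Rightarrow> real^'p) \<Rightarrow> 'a \<Rightarrow> ennreal" where
  "cond_mse M F X v = nn_cond_exp M F (\<lambda>s. ennreal ((norm (X s - v s))\<^sup>2))"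

(* The objective is a random variable; minimality is meant almost surely. *)
definition mmse_minimizer ::
    "'a measure \<Rightarrow> 'a measure \<Rightarrow> ('a \<Rightarrow> real^'p) \<Rightarrow> ('a \<Rightarrow> real^'p) \<Rightarrow> bool" where
  "mmse_minimizer M F X v \<longleftrightarrow>
    v \<in> borel_measurable F \<and>
    (\<forall>v'\<in>borel_measurable F. AE s in M. cond_mse M F X v s \<le> cond_mse M F X v' s)"

definition dual_feasible ::
    "real^'n^'n \<Rightarrow> real^'n^'m \<Rightarrow> real^'n^'p \<Rightarrow> nat \<Rightarrow>
     (nat \<Rightarrow> real^'p^'n) \<Rightarrow> (nat \<Rightarrow> real^'p^'m) \<Rightarrow> bool" where
  "dual_feasible A C K t z \<alpha> \<longleftrightarrow>
    z 0 = transpose K + transpose C ** \<alpha> 0 \<and>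
    (\<forall>i<t. z (Suc i) = transpose A ** z i + transpose C ** \<alpha> (Suc i))"

definition dual_cost ::
    "real^'n^'n \<Rightarrow> real^'n^'n \<Rightarrow> real^'m^'m \<Rightarrow> nat \<Rightarrow>
     (nat \<Rightarrow> real^'p^'n) \<Rightarrow> (nat \<Rightarrow> real^'p^'m) \<Rightarrow> real" where
  "dual_cost S0 Q R t z \<alpha> =
    trace (transpose (z t) ** S0 ** z t + transpose (\<alpha> t) ** R ** \<alpha> t
           + (\<Sum>i<t. transpose (z i) ** Q ** z i + transpose (\<alpha> i) ** R ** \<alpha> i))"

definition dual_solution ::
    "real^'n^'n \<Rightarrow> real^'n^'m \<Rightarrow> real^'n^'p \<Rightarrow> real^'n^'n \<Rightarrow> real^'n^'n \<Rightarrow> real^'m^'m \<Rightarrow> nat \<Rightarrow>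
     (nat \<Rightarrow> real^'p^'n) \<Rightarrow> (nat \<Rightarrow> real^'p^'m) \<Rightarrow> bool" where
  "dual_solution A C K S0 Q R t z \<alpha> \<longleftrightarrow>
    dual_feasible A C K t z \<alpha> \<and>
    (\<forall>z' \<alpha>'. dual_feasible A C K t z' \<alpha>' \<longrightarrow> dual_cost S0 Q R t z \<alpha> \<le> dual_cost S0 Q R t z' \<alpha>')"

definition dual_value ::
    "real^'n^'n \<Rightarrow> real^'n^'m \<Rightarrow> real^'n^'p \<Rightarrow> real^'n^'n \<Rightarrow> real^'n^'n \<Rightarrow> real^'m^'m \<Rightarrow> nat \<Rightarrow> real" where
  "dual_value A C K S0 Q R t = Inf {dual_cost S0 Q R t z \<alpha> |z \<alpha>. dual_feasible A C K t z \<alpha>}"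

end

theory Submission
  imports Defs
begin

text \<open>
Unrolling the dynamics along a feasible pair $(z, \alpha)$ writes $K x_t$ as the affine function of the
data in the claim plus the error
$z_t^T (x_0 - \hat x_0^-) + \sum_{i<t} z_i^T \xi_{t-1-i} + \sum_{i \le t} \alpha_i^T \omega_{t-i}$,
whose mean square is the dual cost. Varying $\alpha$ by $\delta$ changes the error by
$\sum_i \delta_i^T \tilde y_{t-i}$, where $\tilde y$ is the output of the centred system without input.
So optimality of $\alpha$ says that the error is uncorrelated with $\tilde y_0, \dots, \tilde y_t$; by
joint Gaussianity it is independent of them and of the exogenous randomness. As inputs are causal,
everything observed up to time $t$ is a function of these. Hence the affine function is the conditional
mean and the conditional mean square error is constant, equal to the optimal dual cost. As
the inputs may fail to be integrable, the conditional expectations are computed with Fubini's theorem.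

Everything on the dual side is done column by column: column $j$ of $(z, \alpha)$ belongs to row $j$ of $K$.
\<close>

section \<open>Normal laws and characteristic functions\<close>

text \<open>Only scalar projections of each source are assumed normal, with covariances that may be
  singular, so densities are of no help. Joint Gaussianity is carried by one formula instead: the
  mean of \<open>indicator G0 s * cos (noise t f s + c)\<close> is \<open>prob G0 * cos c\<close>
  times the exponential of minus half the cost of \<open>f\<close>. Orthogonality makes costs
  additive, hence such means factor, and cosines are then exchanged for indicators of events.

  Feedback is the obstacle to arguing with the measurements themselves: an input may be a nonlinear
  function of past outputs and of exogenous randomness, so \<open>y\<close> need not be Gaussian and
  lack of correlation with it would prove nothing. The centred outputs are linear in the noises
  whatever the inputs are. Independence is proved for the larger sigma-algebra that they generate
  together with \<open>G\<close>, and is inherited by the observed one.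

  Since \<open>R\<close> may be singular as well, existence of a dual optimum does not rest on
  inverting anything; it comes from a projection with respect to a degenerate form.\<close>

lemma integral_cis_normal_law:
  assumes "0 \<le> v"
  shows "(CLINT x|normal_law m v. cis (r * x)) = cis (r * m) * exp (- v * r\<^sup>2 / 2)"
proof (cases "v = 0")
  case True
  have [measurable]: "(\<lambda>x. cis (r * x)) \<in> borel_measurable borel"
    unfolding cis_conv_exp by measurable
  from True show ?thesis by (simp add: normal_law_def integral_return)
next
  case False
  with assms have v: "0 < sqrt v" by simp
  let ?S = "density lborel std_normal_density"
  interpret S: prob_space ?S
    using prob_space_normal_density[of 1 0] by simp
  have "distributed ?S lborel (\<lambda>x. x) std_normal_density"
    by (auto simp: distributed_def distr_id2)
  then have "distributed ?S lborel (\<lambda>x. m + sqrt v * x) (normal_density m (sqrt v))"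
    using S.normal_density_affine[of "\<lambda>x. x" 0 1 "sqrt v" m] v by simp
  then have "distr ?S lborel (\<lambda>x. m + sqrt v * x) = normal_law m v"
    using False by (simp add: distributed_def normal_law_def)
  then have "(CLINT x|normal_law m v. cis (r * x)) = (CLINT x|distr ?S lborel (\<lambda>x. m + sqrt v * x). cis (r * x))"
    by simp
  also have "\<dots> = (CLINT x|?S. cis (r * (m + sqrt v * x)))"
    by (subst integral_distr) (auto simp: cis_conv_exp)
  also have "\<dots> = (CLINT x|?S. cis (r * m) * iexp (r * sqrt v * x))"
    by (simp add: cis_mult[symmetric] distrib_left cis_conv_exp exp_add mult.assoc)
  also have "\<dots> = cis (r * m) * char ?S (r * sqrt v)"
    by (simp add: char_def)
  also have "\<dots> = cis (r * m) * exp (- v * r\<^sup>2 / 2)"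
    using assms by (simp add: char_std_normal_distribution power_mult_distrib mult.commute exp_of_real)
  finally show ?thesis .
qed

lemma (in prob_space) expectation_cis_normal_law:
  assumes [measurable]: "X \<in> borel_measurable M" and "0 \<le> v" and X: "distr M borel X = normal_law m v"
  shows "(CLINT s|M. cis (r * X s)) = cis (r * m) * exp (- v * r\<^sup>2 / 2)"
proof -
  have "(CLINT s|M. cis (r * X s)) = (CLINT x|distr M borel X. cis (r * x))"
    by (subst integral_distr) (auto simp: cis_conv_exp)
  with X integral_cis_normal_law[OF assms(2)] show ?thesis by simp
qed

text \<open>The point mass at \<open>v = 0\<close> has to be included, because a singular covariance
  can make the estimation error degenerate.\<close>

lemma normal_law_moments:
  assumes "0 \<le> v"
  shows "integrable (normal_law 0 v) (\<lambda>x. x)" "integral\<^sup>L (normal_law 0 v) (\<lambda>x. x) = 0"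
    "integrable (normal_law 0 v) (\<lambda>x. x\<^sup>2)" "integral\<^sup>L (normal_law 0 v) (\<lambda>x. x\<^sup>2) = v"
proof -
  have "has_bochner_integral (normal_law 0 v) (\<lambda>x. x) 0 \<and> has_bochner_integral (normal_law 0 v) (\<lambda>x. x\<^sup>2) v"
  proof (cases "v = 0")
    case True
    have ret: "has_bochner_integral (return borel (0::real)) f (f 0)" if f: "f \<in> borel_measurable borel"
      for f :: "real \<Rightarrow> real"
    proof -
      interpret prob_space "return borel (0::real)" by (rule prob_space_return) simp
      have ae: "AE x in return borel (0::real). f x = f 0" using f by (subst AE_return) auto
      have "has_bochner_integral (return borel (0::real)) f (f 0) \<longleftrightarrow> has_bochner_integral (return borel (0::real)) (\<lambda>_. f 0) (f 0)"
        using has_bochner_integral_cong_AE[of f "return borel 0" "\<lambda>_. f 0" "f 0"] f ae by simp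
      moreover have "has_bochner_integral (return borel (0::real)) (\<lambda>_. f 0) (f 0)"
        using prob_space by (simp add: has_bochner_integral_iff)
      ultimately show ?thesis by simp
    qed
    have "normal_law 0 v = return borel 0" using True by (simp only: normal_law_def if_True simp_thms)
    moreover have "has_bochner_integral (return borel (0::real)) (\<lambda>x. x) 0" by (rule ret) measurable
    moreover have "has_bochner_integral (return borel (0::real)) (\<lambda>x. x\<^sup>2) (0\<^sup>2)" by (rule ret) measurable
    ultimately show ?thesis by (simp only: True zero_power2 simp_thms)
  next
    case False
    with assms have v: "0 < sqrt v" by simp
    \<comment> \<open>Index 0 of the odd and index 1 of the even moment formula, that is, mean and
      variance.\<close>
    show ?thesis
      using normal_moment_odd[OF v, of 0 0] normal_moment_even[OF v, of 0 1] False assms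
      by (auto simp: normal_law_def has_bochner_integral_iff integrable_density integral_density normal_density_nonneg)
  qed
  then show "integrable (normal_law 0 v) (\<lambda>x. x)" "integral\<^sup>L (normal_law 0 v) (\<lambda>x. x) = 0"
    "integrable (normal_law 0 v) (\<lambda>x. x\<^sup>2)" "integral\<^sup>L (normal_law 0 v) (\<lambda>x. x\<^sup>2) = v"
    by (auto simp: has_bochner_integral_iff)
qed

lemma prob_space_normal_law: "0 \<le> v \<Longrightarrow> prob_space (normal_law m v)"
  by (auto simp: normal_law_def intro: prob_space_return prob_space_normal_density)

lemma sets_normal_law [simp, measurable_cong]: "sets (normal_law m v) = sets borel"
  by (auto simp: normal_law_def)

text \<open>Levy uniqueness on the line. It will identify the law of a noise combination, whose
  first two moments are then those of a normal law.\<close>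

lemma (in prob_space) distr_normal_law_if_char:
  assumes [measurable]: "X \<in> borel_measurable M" and v: "0 \<le> v"
    and cf: "\<And>r. (CLINT s|M. cis (r * X s)) = cis (r * m) * exp (- v * r\<^sup>2 / 2)"
  shows "distr M borel X = normal_law m v"
proof (rule Levy_uniqueness)
  show "real_distribution (normal_law m v)"
    using prob_space_normal_law[OF v] by (simp add: real_distribution_def real_distribution_axioms_def)
  show "char (distr M borel X) = char (normal_law m v)"
  proof
    fix r
    have "char (distr M borel X) r = (CLINT s|M. cis (r * X s))"
      unfolding char_def by (subst integral_distr) (auto simp: cis_conv_exp)
    also have "\<dots> = char (normal_law m v) r"
      using cf[of r] integral_cis_normal_law[OF v, of m r] by (simp add: char_def cis_conv_exp)
    finally show "char (distr M borel X) r = char (normal_law m v) r" .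
  qed
qed simp

section \<open>Signed weights that integrate every cosine to zero\<close>

lemma abs_mult_le_bound:
  fixes a b c :: real
  assumes "\<bar>a\<bar> \<le> c" "\<bar>b\<bar> \<le> 1"
  shows "\<bar>a * b\<bar> \<le> c"
  using mult_mono[of "\<bar>a\<bar>" c "\<bar>b\<bar>" 1] assms by (simp add: abs_mult)

lemma (in finite_measure) integrable_mult_bounded:
  fixes W h :: "'a \<Rightarrow> real"
  assumes "W \<in> borel_measurable M" "h \<in> borel_measurable M"
    and "\<And>s. s \<in> space M \<Longrightarrow> \<bar>W s\<bar> \<le> c" "\<And>s. \<bar>h s\<bar> \<le> 1"
  shows "integrable M (\<lambda>s. W s * h s)"
  by (rule integrable_const_bound[where B = c]) (use assms in \<open>auto intro!: AE_I2 abs_mult_le_bound simp del: abs_mult\<close>)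

text \<open>The weight is shifted and rescaled to the density of a probability measure.\<close>

lemma (in prob_space) integral_mult_indicator_eq_0_if_cos:
  fixes W X :: "'a \<Rightarrow> real"
  assumes [measurable]: "W \<in> borel_measurable M" "X \<in> borel_measurable M"
    and bound: "\<And>s. s \<in> space M \<Longrightarrow> \<bar>W s\<bar> \<le> c"
    and cos0: "\<And>r d. (LINT s|M. W s * cos (r * X s + d)) = 0"
    and [measurable]: "S \<in> sets borel"
  shows "(LINT s|M. W s * indicator S (X s)) = 0"
proof -
  \<comment> \<open>Dividing by a bound of the weight keeps \<open>f\<close> non-negative; the added
    1 keeps the divisor positive when \<open>c = 0\<close>.\<close>
  define k where "k = \<bar>c\<bar> + 1"
  have k: "0 < k" by (simp add: k_def)
  define f where "f s = 1 + W s / k" for s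
  have f0: "0 \<le> f s" if "s \<in> space M" for s
  proof -
    have "\<bar>W s / k\<bar> \<le> 1" using bound[OF that] k by (simp add: k_def)
    then have "- 1 \<le> W s / k" by linarith
    then show ?thesis by (simp add: f_def)
  qed
  have [measurable]: "f \<in> borel_measurable M" unfolding f_def by measurable
  have intW: "integrable M (\<lambda>s. W s * h s)" if [measurable]: "h \<in> borel_measurable M" and "\<And>s. \<bar>h s\<bar> \<le> 1" for h
    by (rule integrable_mult_bounded[where c = c]) (use that bound in auto)
  \<comment> \<open>The cosine with zero frequency and phase is 1, so the weight has mean zero. This
    is why \<open>f\<close> integrates to 1.\<close>
  have W0: "(LINT s|M. W s) = 0" and iW: "integrable M W"
    using cos0[of 0 0] intW[of "\<lambda>_. 1"] by simp_all
  let ?P = "density M (\<lambda>s. ennreal (f s))"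
  have "emeasure ?P (space ?P) = (\<integral>\<^sup>+s. ennreal (f s) \<partial>M)"
    by (simp add: emeasure_density cong: nn_integral_cong)
  also have "\<dots> = ennreal (LINT s|M. f s)"
    by (intro nn_integral_eq_integral AE_I2 f0) (auto simp: f_def iW)
  also have "(LINT s|M. f s) = 1"
    using W0 iW by (simp add: f_def prob_space)
  finally interpret P: prob_space ?P by (intro prob_spaceI) simp
  have dens: "(LINT s|?P. h s) = (LINT s|M. f s *\<^sub>R h s)" if "h \<in> borel_measurable M"
    for h :: "'a \<Rightarrow> 'b::{banach,second_countable_topology}"
    by (rule integral_density) (use that f0 in \<open>auto intro!: AE_I2\<close>)
  have "distr ?P borel X = distr M borel X"
  proof (rule Levy_uniqueness)
    show "char (distr ?P borel X) = char (distr M borel X)"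
    proof
      fix r
      have iC: "integrable M (\<lambda>s. W s *\<^sub>R iexp (r * X s))"
        by (rule integrable_const_bound[where B = "\<bar>c\<bar>"])
           (auto intro!: AE_I2 order_trans[OF bound])
      have iI: "integrable M (\<lambda>s. iexp (r * X s))"
        by (rule integrable_const_bound[where B = 1]) (auto intro!: AE_I2)
      \<comment> \<open>The phases 0 and \<open>- pi / 2\<close> turn the assumption on cosines into
        the vanishing of real and imaginary part.\<close>
      have "Re (CLINT s|M. W s *\<^sub>R iexp (r * X s)) = (LINT s|M. W s * cos (r * X s + 0))"
        using iC by (subst integral_Re[symmetric]) (auto simp: Re_exp)
      moreover have "Im (CLINT s|M. W s *\<^sub>R iexp (r * X s)) = (LINT s|M. W s * cos (r * X s + (- pi / 2)))"
        using iC by (subst integral_Im[symmetric]) (auto simp: Im_exp cos_diff)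
      ultimately have 0: "(CLINT s|M. W s *\<^sub>R iexp (r * X s)) = 0"
        using cos0[of r 0] cos0[of r "- pi / 2"] by (simp add: complex_eq_iff)
      have "char (distr ?P borel X) r = (CLINT s|M. f s *\<^sub>R iexp (r * X s))"
        unfolding char_def by (subst integral_distr) (auto simp: dens)
      also have "\<dots> = (CLINT s|M. iexp (r * X s) + (1/k) *\<^sub>R (W s *\<^sub>R iexp (r * X s)))"
        by (simp add: f_def scaleR_add_left)
      also have "\<dots> = (CLINT s|M. iexp (r * X s))"
      proof (subst Bochner_Integration.integral_add)
        show "(CLINT s|M. iexp (r * X s)) + (CLINT s|M. (1/k) *\<^sub>R (W s *\<^sub>R iexp (r * X s))) = (CLINT s|M. iexp (r * X s))"
          by (subst integral_scaleR_right) (simp only: 0 scaleR_zero_right add_0_right)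
      qed (rule iI integrable_scaleR_right[OF iC])+
      also have "\<dots> = char (distr M borel X) r"
        unfolding char_def by (subst integral_distr) auto
      finally show "char (distr ?P borel X) r = char (distr M borel X) r" .
    qed
  qed (auto intro!: P.real_distribution_distr)
  then have "(LINT s|?P. indicator S (X s) :: real) = (LINT s|M. indicator S (X s))"
    by (subst (1 2) integral_distr[of X _ borel "indicator S", symmetric]) auto
  then have eq: "(LINT s|M. f s * indicator S (X s)) = (LINT s|M. indicator S (X s))"
    by (simp add: dens)
  have "integrable M (\<lambda>s. indicator S (X s) :: real)"
    by (rule integrable_const_bound[where B = 1]) (auto intro!: AE_I2)
  moreover have iWS: "integrable M (\<lambda>s. W s * indicator S (X s))"
    by (rule intW) (auto split: split_indicator)
  moreover have "(LINT s|M. f s * indicator S (X s)) = (LINT s|M. indicator S (X s) + (1/k) * (W s * indicator S (X s)))"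
    by (simp add: f_def distrib_right)
  ultimately show ?thesis using eq k by simp
qed

text \<open>
A replacement for uniqueness of multivariate characteristic functions: the variables are traded for
indicators one at a time, the remaining cosine being part of the signed weight.
\<close>

lemma (in prob_space) integral_mult_prod_indicator_eq_0_if_cos:
  fixes W :: "'a \<Rightarrow> real" and V :: "'i \<Rightarrow> 'a \<Rightarrow> real"
  assumes "finite J"
    and W: "W \<in> borel_measurable M" and V [measurable]: "\<And>j. j \<in> J \<Longrightarrow> V j \<in> borel_measurable M"
    and "\<And>s. s \<in> space M \<Longrightarrow> \<bar>W s\<bar> \<le> c"
    and "\<And>b d. (LINT s|M. W s * cos ((\<Sum>j\<in>J. b j * V j s) + d)) = 0"
    and "\<And>j. j \<in> J \<Longrightarrow> S j \<in> sets borel"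
  shows "(LINT s|M. W s * (\<Prod>j\<in>J. indicator (S j) (V j s))) = 0"
  using assms
proof (induction J arbitrary: W rule: finite_induct)
  case empty
  from empty(4)[of _ 0] show ?case by simp
next
  case (insert j J)
  have [measurable]: "V i \<in> borel_measurable M" if "i \<in> insert j J" for i by (rule insert(5)[OF that])
  note [measurable] = insert.prems(1)
  have S[measurable]: "S j \<in> sets borel" using insert.prems by simp
  have "(LINT s|M. (W s * indicator (S j) (V j s)) * (\<Prod>i\<in>J. indicator (S i) (V i s))) = 0"
  proof (rule insert.IH)
    show "(\<lambda>s. W s * indicator (S j) (V j s)) \<in> borel_measurable M" by measurable
    show "\<bar>W s * indicator (S j) (V j s)\<bar> \<le> c" if "s \<in> space M" for s
      using insert.prems(3)[OF that] by (auto split: split_indicator)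
    fix b d
    let ?T = "\<lambda>s. (\<Sum>i\<in>J. b i * V i s) + d"
    have [measurable]: "?T \<in> borel_measurable M" by measurable
    have "(LINT s|M. (W s * cos (?T s)) * indicator (S j) (V j s)) = 0"
    proof (rule integral_mult_indicator_eq_0_if_cos[where c = c])
      show "\<bar>W s * cos (?T s)\<bar> \<le> c" if "s \<in> space M" for s
        using abs_mult_le_bound[OF insert.prems(3)[OF that] abs_cos_le_one] .
      fix r e
      have int: "integrable M (\<lambda>s. W s * cos (?T s + q * (r * V j s + e)))" for q
        by (rule integrable_mult_bounded[where c = c]) (use insert.prems(3) in auto)
      \<comment> \<open>Only \<open>q = 1\<close> and \<open>q = -1\<close> matter: a product of two
        cosines is half the sum of the cosines of sum and difference. Giving \<open>V j\<close> the
        coefficient \<open>q * r\<close> brings both under the hypothesis for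
        \<open>insert j J\<close>.\<close>
      have zero: "(LINT s|M. W s * cos (?T s + q * (r * V j s + e))) = 0" for q
      proof -
        have "(\<Sum>i\<in>insert j J. (b(j := q * r)) i * V i s) = (\<Sum>i\<in>J. b i * V i s) + q * r * V j s" for s
          using insert.hyps by (simp add: sum.insert) (intro sum.cong, auto)
        then show ?thesis using insert.prems(4)[of "b(j := q * r)" "d + q * e"]
          by (simp add: algebra_simps)
      qed
      have "v * cos p * cos q = (1/2) * (v * cos (p + 1 * q)) + (1/2) * (v * cos (p + (-1) * q))" for v p q :: real
        by (simp add: cos_add cos_diff algebra_simps)
      then have "(LINT s|M. W s * cos (?T s) * cos (r * V j s + e)) =
          (LINT s|M. (1/2) * (W s * cos (?T s + 1 * (r * V j s + e))) + (1/2) * (W s * cos (?T s + (-1) * (r * V j s + e))))"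
        by (intro Bochner_Integration.integral_cong refl)
      also have "\<dots> = 0"
        by (subst Bochner_Integration.integral_add)
           (simp_all only: int zero integral_mult_right_zero integrable_mult_right mult_zero_right add_0_left)
      finally show "(LINT s|M. W s * cos (?T s) * cos (r * V j s + e)) = 0" .
    qed (use S in \<open>auto simp: S\<close>)
    then show "(LINT s|M. W s * indicator (S j) (V j s) * cos (?T s)) = 0"
      by (simp add: mult.assoc mult.commute[of "cos _"])
  qed (use insert in auto)
  then show ?case using insert.hyps by (simp add: mult.assoc)
qed

section \<open>Conditional expectations under independence\<close>

text \<open>The freezing lemma. Independence means that the identity, read as a map into
  \<open>F\<close>, and \<open>e\<close> have a product joint law, so Tonelli averages over
  \<open>e\<close> while the \<open>F\<close>-measurable argument stays fixed. Working with
  non-negative \<open>f\<close> avoids any question of integrability.\<close>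

lemma (in prob_space) nn_cond_exp_indep:
  fixes f :: "'a \<times> real \<Rightarrow> ennreal"
  assumes sub: "subalgebra M F" and [measurable]: "e \<in> borel_measurable M"
    and ind: "\<And>D S. D \<in> sets F \<Longrightarrow> S \<in> sets borel \<Longrightarrow>
      prob (D \<inter> (e -` S \<inter> space M)) = prob D * prob (e -` S \<inter> space M)"
    and f [measurable]: "f \<in> borel_measurable (F \<Otimes>\<^sub>M borel)"
  shows "AE s in M. nn_cond_exp M F (\<lambda>s. f (s, e s)) s = (\<integral>\<^sup>+s'. f (s, e s') \<partial>M)"
proof -
  interpret finite_measure_subalgebra M F by unfold_locales (rule sub)
  have [measurable]: "(\<lambda>s. s) \<in> measurable M F"
    using sub by (rule measurable_from_subalg) simp
  have spF: "space F = space M" and setsF: "sets F \<subseteq> sets M"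
    using sub by (auto simp: subalgebra_def)
  \<comment> \<open>\<open>?M1\<close> is \<open>M\<close> restricted to the events of
    \<open>F\<close>, written as an image under the identity. The product then lives on
    \<open>F \<Otimes>\<^sub>M borel\<close>, where \<open>f\<close> is measurable.\<close>
  let ?M1 = "distr M F (\<lambda>s. s)" and ?M2 = "distr M borel e"
  interpret M1: prob_space ?M1 by (rule prob_space_distr) simp
  interpret M2: prob_space ?M2 by (rule prob_space_distr) simp
  have pair: "?M1 \<Otimes>\<^sub>M ?M2 = distr M (F \<Otimes>\<^sub>M borel) (\<lambda>s. (s, e s))"
  proof (rule pair_measure_eqI)
    fix D S assume "D \<in> sets ?M1" "S \<in> sets ?M2"
    then have [measurable]: "D \<in> sets F" "S \<in> sets borel" by auto
    have "D \<subseteq> space M" using sets.sets_into_space[OF \<open>D \<in> sets F\<close>] spF by simp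
    then have eq: "(\<lambda>s. s) -` D \<inter> space M = D" "(\<lambda>s. (s, e s)) -` (D \<times> S) \<inter> space M = D \<inter> (e -` S \<inter> space M)"
      by auto
    show "emeasure ?M1 D * emeasure ?M2 S = emeasure (distr M (F \<Otimes>\<^sub>M borel) (\<lambda>s. (s, e s))) (D \<times> S)"
      using eq(1) by (simp add: emeasure_distr eq(2) emeasure_eq_measure ind ennreal_mult)
  qed (auto intro: M1.sigma_finite_measure_axioms M2.sigma_finite_measure_axioms)
  have "AE s in M. (\<integral>\<^sup>+s'. f (s, e s') \<partial>M) = nn_cond_exp M F (\<lambda>s. f (s, e s)) s"
  proof (rule nn_cond_exp_charact)
    have "(\<lambda>s. \<integral>\<^sup>+r. f (s, r) \<partial>?M2) \<in> borel_measurable F"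
      by (rule M2.borel_measurable_nn_integral) simp
    then show [measurable]: "(\<lambda>s. \<integral>\<^sup>+s'. f (s, e s') \<partial>M) \<in> borel_measurable F"
      by (simp add: nn_integral_distr cong: measurable_cong)
    show "(\<lambda>s. f (s, e s)) \<in> borel_measurable M" by measurable
    fix D assume D [measurable]: "D \<in> sets F"
    have "(\<integral>\<^sup>+s\<in>D. f (s, e s) \<partial>M) = (\<integral>\<^sup>+q. f q * indicator D (fst q) \<partial>distr M (F \<Otimes>\<^sub>M borel) (\<lambda>s. (s, e s)))"
      by (simp add: nn_integral_distr)
    also have "\<dots> = (\<integral>\<^sup>+s. (\<integral>\<^sup>+r. f (s, r) * indicator D s \<partial>?M2) \<partial>?M1)"
      unfolding pair[symmetric] by (subst M2.nn_integral_fst[symmetric]) auto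
    also have "\<dots> = (\<integral>\<^sup>+s. (\<integral>\<^sup>+r. f (s, r) * indicator D s \<partial>?M2) \<partial>M)"
      by (rule nn_integral_distr) (simp, rule M2.borel_measurable_nn_integral, simp)
    also have "\<dots> = (\<integral>\<^sup>+s\<in>D. (\<integral>\<^sup>+s'. f (s, e s') \<partial>M) \<partial>M)"
    proof (intro nn_integral_cong)
      fix s assume "s \<in> space M"
      then have [measurable]: "(\<lambda>r. f (s, r)) \<in> borel_measurable borel"
        by (intro measurable_Pair2[OF f]) (simp add: spF)
      have "(\<integral>\<^sup>+r. f (s, r) * indicator D s \<partial>?M2) = (\<integral>\<^sup>+r. f (s, r) \<partial>?M2) * indicator D s"
        by (rule nn_integral_multc) simp
      also have "(\<integral>\<^sup>+r. f (s, r) \<partial>?M2) = (\<integral>\<^sup>+s'. f (s, e s') \<partial>M)"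
        by (rule nn_integral_distr) simp_all
      finally show "(\<integral>\<^sup>+r. f (s, r) * indicator D s \<partial>?M2) = (\<integral>\<^sup>+s'. f (s, e s') \<partial>M) * indicator D s" .
    qed
    finally show "(\<integral>\<^sup>+s\<in>D. f (s, e s) \<partial>M) = (\<integral>\<^sup>+s\<in>D. (\<integral>\<^sup>+s'. f (s, e s') \<partial>M) \<partial>M)" .
  qed
  then show ?thesis by eventually_elim simp
qed

text \<open>\<open>real_cond_exp\<close> is the difference of the conditional expectations of
  positive and negative part. Freezing evaluates both, and for a fixed value of \<open>L s\<close>
  the variable \<open>L s + e s'\<close> is integrable with mean \<open>L s\<close>. So
  \<open>L\<close> may be any \<open>F\<close>-measurable function.\<close>

lemma (in prob_space) real_cond_exp_add_indep:
  fixes L e :: "'a \<Rightarrow> real"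
  assumes sub: "subalgebra M F" and ind: "\<And>D S. D \<in> sets F \<Longrightarrow> S \<in> sets borel \<Longrightarrow>
      prob (D \<inter> (e -` S \<inter> space M)) = prob D * prob (e -` S \<inter> space M)"
    and L [measurable]: "L \<in> borel_measurable F" and int: "integrable M e" "expectation e = 0"
  shows "AE s in M. real_cond_exp M F (\<lambda>s. L s + e s) s = L s"
proof -
  have e [measurable]: "e \<in> borel_measurable M" using int by auto
  have "AE s in M. nn_cond_exp M F (\<lambda>s. ennreal (c * (L s + e s))) s = (\<integral>\<^sup>+s'. ennreal (c * (L s + e s')) \<partial>M)" for c
  proof -
    have "(\<lambda>q. ennreal (c * (L (fst q) + snd q))) \<in> borel_measurable (F \<Otimes>\<^sub>M borel)"
      by measurable
    from nn_cond_exp_indep[OF sub e ind this] show ?thesis by (simp only: fst_conv snd_conv)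
  qed
  from this[of 1] this[of "-1"]
  have "AE s in M. nn_cond_exp M F (\<lambda>s. ennreal (L s + e s)) s = (\<integral>\<^sup>+s'. ennreal (L s + e s') \<partial>M)"
    "AE s in M. nn_cond_exp M F (\<lambda>s. ennreal (- (L s + e s))) s = (\<integral>\<^sup>+s'. ennreal (- (L s + e s')) \<partial>M)"
    by (simp_all only: mult_1 mult_minus1)
  then show ?thesis
  proof eventually_elim
    case (elim s)
    have "(LINT s'|M. L s + e s') = L s" using int by (simp add: prob_space)
    moreover have "integrable M (\<lambda>s'. L s + e s')" using int by simp
    ultimately show ?case
      unfolding real_cond_exp_def elim by (subst (asm) real_lebesgue_integral_def) auto
  qed
qed

lemma (in sigma_finite_subalgebra) nn_cond_exp_setsum:
  assumes "finite J" and [measurable]: "\<And>j. j \<in> J \<Longrightarrow> f j \<in> borel_measurable M"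
  shows "AE s in M. (\<Sum>j\<in>J. nn_cond_exp M F (f j) s) = nn_cond_exp M F (\<lambda>s. \<Sum>j\<in>J. f j s) s"
  using assms
proof (induction J)
  case empty
  have "AE s in M. 0 = nn_cond_exp M F (\<lambda>s. 0) s" by (rule nn_cond_exp_F_meas) simp
  then show ?case by simp
next
  case (insert j J)
  then have [measurable]: "f i \<in> borel_measurable M" if "i \<in> insert j J" for i using that by blast
  have "AE s in M. nn_cond_exp M F (f j) s + nn_cond_exp M F (\<lambda>s. \<Sum>i\<in>J. f i s) s
      = nn_cond_exp M F (\<lambda>s. f j s + (\<Sum>i\<in>J. f i s)) s"
    by (rule nn_cond_exp_sum) simp_all
  moreover have "AE s in M. (\<Sum>i\<in>J. nn_cond_exp M F (f i) s) = nn_cond_exp M F (\<lambda>s. \<Sum>i\<in>J. f i s) s"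
    using insert by simp
  ultimately show ?case by eventually_elim (use insert.hyps in simp)
qed

text \<open>The squared norm is a sum over coordinates, so it is enough that each coordinate of
  \<open>e\<close> on its own is independent of \<open>F\<close>. With \<open>g\<close> frozen the
  square expands, and the cross term has mean zero.\<close>

lemma (in prob_space) nn_cond_exp_norm_add_indep:
  fixes g e :: "'a \<Rightarrow> real^'p"
  assumes sub: "subalgebra M F" and ind: "\<And>j D S. D \<in> sets F \<Longrightarrow> S \<in> sets borel \<Longrightarrow>
      prob (D \<inter> ((\<lambda>s. e s $ j) -` S \<inter> space M)) = prob D * prob ((\<lambda>s. e s $ j) -` S \<inter> space M)"
    and g [measurable]: "g \<in> borel_measurable F"
    and int: "\<And>j. integrable M (\<lambda>s. e s $ j)" "\<And>j. expectation (\<lambda>s. e s $ j) = 0"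
    and int2: "\<And>j. integrable M (\<lambda>s. (e s $ j)\<^sup>2)" "\<And>j. expectation (\<lambda>s. (e s $ j)\<^sup>2) = V j"
  shows "AE s in M. nn_cond_exp M F (\<lambda>s. ennreal ((norm (g s + e s))\<^sup>2)) s = ennreal ((norm (g s))\<^sup>2 + (\<Sum>j\<in>UNIV. V j))"
proof -
  interpret finite_measure_subalgebra M F by unfold_locales (rule sub)
  have e [measurable]: "(\<lambda>s. e s $ j) \<in> borel_measurable M" for j using int(1) by auto
  have gj [measurable]: "(\<lambda>s. g s $ j) \<in> borel_measurable F" for j
    by (rule measurable_compose[OF g]) simp
  have [measurable]: "(\<lambda>s. g s $ j) \<in> borel_measurable M" for j
    by (rule measurable_from_subalg[OF sub gj])
  have V0: "0 \<le> V j" for j using Bochner_Integration.integral_nonneg[of M "\<lambda>s. (e s $ j)\<^sup>2"] by (simp add: int2(2))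
  have sq: "(norm v)\<^sup>2 = (\<Sum>j\<in>UNIV. (v $ j)\<^sup>2)" for v :: "real^'p"
    by (simp add: norm_vec_def L2_set_def sum_nonneg)
  have comp: "AE s in M. nn_cond_exp M F (\<lambda>s. ennreal ((g s $ j + e s $ j)\<^sup>2)) s = ennreal ((g s $ j)\<^sup>2 + V j)" for j
  proof -
    have "AE s in M. nn_cond_exp M F (\<lambda>s. ennreal ((g s $ j + e s $ j)\<^sup>2)) s = (\<integral>\<^sup>+s'. ennreal ((g s $ j + e s' $ j)\<^sup>2) \<partial>M)"
    proof -
      have "(\<lambda>q. ennreal ((g (fst q) $ j + snd q)\<^sup>2)) \<in> borel_measurable (F \<Otimes>\<^sub>M borel)"
        using measurable_compose[OF measurable_fst gj] by measurable
      then show ?thesis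
        using nn_cond_exp_indep[of F "\<lambda>s. e s $ j" "\<lambda>q. ennreal ((g (fst q) $ j + snd q)\<^sup>2)"]
        by (simp add: sub ind)
    qed
    moreover have "(\<integral>\<^sup>+s'. ennreal ((c + e s' $ j)\<^sup>2) \<partial>M) = ennreal (c\<^sup>2 + V j)" for c :: real
    proof -
      have "(c + e s' $ j)\<^sup>2 = c\<^sup>2 + 2 * c * (e s' $ j) + (e s' $ j)\<^sup>2" for s'
        by (simp add: power2_sum)
      then have "integrable M (\<lambda>s'. (c + e s' $ j)\<^sup>2)" "expectation (\<lambda>s'. (c + e s' $ j)\<^sup>2) = c\<^sup>2 + V j"
        using int int2 by (simp_all add: prob_space)
      then show ?thesis by (subst nn_integral_eq_integral) simp_all
    qed
    ultimately show ?thesis by simp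
  qed
  have "AE s in M. \<forall>j\<in>UNIV. nn_cond_exp M F (\<lambda>s. ennreal ((g s $ j + e s $ j)\<^sup>2)) s = ennreal ((g s $ j)\<^sup>2 + V j)"
    by (rule AE_finite_allI) (auto simp: comp)
  moreover have "AE s in M. (\<Sum>j\<in>UNIV. nn_cond_exp M F (\<lambda>s. ennreal ((g s $ j + e s $ j)\<^sup>2)) s)
      = nn_cond_exp M F (\<lambda>s. \<Sum>j\<in>UNIV. ennreal ((g s $ j + e s $ j)\<^sup>2)) s"
    by (rule nn_cond_exp_setsum) auto
  ultimately show ?thesis
  proof eventually_elim
    case (elim s)
    have "nn_cond_exp M F (\<lambda>s. ennreal ((norm (g s + e s))\<^sup>2)) s
        = nn_cond_exp M F (\<lambda>s. \<Sum>j\<in>UNIV. ennreal ((g s $ j + e s $ j)\<^sup>2)) s"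
      by (simp add: sq sum_ennreal)
    also have "\<dots> = (\<Sum>j\<in>UNIV. ennreal ((g s $ j)\<^sup>2 + V j))" using elim by simp
    also have "\<dots> = ennreal ((norm (g s))\<^sup>2 + (\<Sum>j\<in>UNIV. V j))"
      using V0 by (subst sum_ennreal) (auto simp: sq sum.distrib)
    finally show ?case .
  qed
qed

section \<open>The dual problem\<close>

text \<open>
Gram--Schmidt for a possibly degenerate form. The last conjunct stands in for ``$q$ lies in the span
of $D$''.
\<close>

lemma psd_form_projection:
  fixes b :: "('i \<Rightarrow> 'v::real_vector) \<Rightarrow> ('i \<Rightarrow> 'v) \<Rightarrow> real"
  assumes add: "\<And>f g h. b (\<lambda>i. f i + g i) h = b f h + b g h"
    and scale: "\<And>c f h. b (\<lambda>i. c *\<^sub>R f i) h = c * b f h"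
    and sym: "\<And>f g. b f g = b g f" and psd: "\<And>f. 0 \<le> b f f"
    and S_add: "\<And>f g. f \<in> S \<Longrightarrow> g \<in> S \<Longrightarrow> (\<lambda>i. f i + g i) \<in> S"
    and S_scale: "\<And>c f. f \<in> S \<Longrightarrow> (\<lambda>i. c *\<^sub>R f i) \<in> S" and S0: "(\<lambda>_. 0) \<in> S"
    and "finite D" "D \<subseteq> S"
  shows "\<exists>q\<in>S. (\<forall>d\<in>D. b (\<lambda>i. e i + q i) d = 0) \<and> (\<forall>f. (\<forall>d\<in>D. b f d = 0) \<longrightarrow> b f q = 0)"
  using \<open>finite D\<close> \<open>D \<subseteq> S\<close>
proof (induction D arbitrary: e)
  case empty
  have "b f (\<lambda>_. 0) = 0" for f
    using scale[of 0 "\<lambda>_. 0" f] by (simp add: sym)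
  then show ?case using S0 by (intro bexI[of _ "\<lambda>_. 0"]) auto
next
  case (insert x D)
  have addr: "b h (\<lambda>i. f i + g i) = b h f + b h g" for f g h using add sym by metis
  have scaler: "b h (\<lambda>i. c *\<^sub>R f i) = c * b h f" for c f h using scale sym by metis
  from insert obtain q where q: "q \<in> S" "\<And>d. d \<in> D \<Longrightarrow> b (\<lambda>i. e i + q i) d = 0"
    "\<And>f. (\<And>d. d \<in> D \<Longrightarrow> b f d = 0) \<Longrightarrow> b f q = 0" by (metis insert_subset)
  from insert obtain p where p: "p \<in> S" "\<And>d. d \<in> D \<Longrightarrow> b (\<lambda>i. x i + p i) d = 0"
    "\<And>f. (\<And>d. d \<in> D \<Longrightarrow> b f d = 0) \<Longrightarrow> b f p = 0" by (metis insert_subset)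
  define y where "y = (\<lambda>i. x i + p i)"
  define e1 where "e1 = (\<lambda>i. e i + q i)"
  \<comment> \<open>The Gram--Schmidt coefficient of \<open>e1\<close> against \<open>y\<close>, the
    part of \<open>x\<close> orthogonal to \<open>D\<close>. For \<open>b y y = 0\<close> the
    quotient is 0.\<close>
  define c where "c = - (b e1 y / b y y)"
  have yS: "y \<in> S" unfolding y_def using insert.prems p(1) S_add by auto
  have ce: "b e1 y + c * b y y = 0"
  proof (cases "b y y = 0")
    case True
    \<comment> \<open>A null vector of a positive semidefinite form lies in its radical: otherwise
      the form at \<open>e1 + r y\<close> would be affine in \<open>r\<close> with nonzero slope.
      The \<open>r\<close> inserted below would make it -1.\<close>
    have "b e1 y = 0"
    proof (rule ccontr)
      assume ne: "b e1 y \<noteq> 0"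
      have "0 \<le> b (\<lambda>i. e1 i + r *\<^sub>R y i) (\<lambda>i. e1 i + r *\<^sub>R y i)" for r by (rule psd)
      then have "0 \<le> b e1 e1 + 2 * r * b e1 y" for r
        using True by (simp add: add addr scale scaler sym[of y e1] algebra_simps)
      from this[of "- (b e1 e1 + 1) / (2 * b e1 y)"] ne show False by (simp add: field_simps)
    qed
    then show ?thesis using True by simp
  qed (simp add: c_def)
  let ?q = "\<lambda>i. q i + c *\<^sub>R y i"
  have eq: "(\<lambda>i. e i + ?q i) = (\<lambda>i. e1 i + c *\<^sub>R y i)" by (simp add: e1_def add.assoc)
  have orth: "b (\<lambda>i. e1 i + c *\<^sub>R y i) d = 0" if "d \<in> D" for d
    using q(2)[OF that] p(2)[OF that] by (simp add: add scale e1_def y_def)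
  have "b (\<lambda>i. e1 i + c *\<^sub>R y i) x = 0"
  proof -
    have "b (\<lambda>i. e1 i + c *\<^sub>R y i) y = 0" using ce by (simp add: add scale)
    \<comment> \<open>\<open>p\<close> behaves like a combination of members of \<open>D\<close>, so
      orthogonality to \<open>D\<close> carries over to \<open>p\<close>, and then to
      \<open>x\<close>, which is \<open>y\<close> minus \<open>p\<close>.\<close>
    moreover have "b (\<lambda>i. e1 i + c *\<^sub>R y i) p = 0" by (rule p(3)) (rule orth)
    ultimately show ?thesis unfolding y_def by (simp add: addr)
  qed
  moreover have "b f ?q = 0" if "\<forall>d\<in>insert x D. b f d = 0" for f
    using that p(3)[of f] q(3)[of f] by (simp add: addr scaler y_def)
  moreover have "?q \<in> S" by (intro S_add S_scale yS q(1))
  ultimately show ?case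
    using orth eq by (intro bexI[of _ ?q]) (auto simp: eq)
qed

text \<open>Vanishing of the first variation. The witness \<open>- p / (q + 1)\<close> minimises the
  quadratic with \<open>q\<close> enlarged by 1, which avoids dividing by zero when
  \<open>q = 0\<close>.\<close>

lemma linear_coeff_eq_0:
  fixes p q :: real
  assumes "\<And>r. 0 \<le> 2 * r * p + r\<^sup>2 * q" "0 \<le> q"
  shows "p = 0"
proof (rule ccontr)
  assume "p \<noteq> 0"
  define k where "k = q + 1"
  have k: "0 < k" "q = k - 1" using assms(2) by (simp_all add: k_def)
  have "0 \<le> 2 * (- p / k) * p + (- p / k)\<^sup>2 * (k - 1)" using assms(1)[of "- p / k"] k(2) by simp
  also have "\<dots> = - (p\<^sup>2 * (k + 1) / k\<^sup>2)" using k(1) by (simp add: field_simps power2_eq_square)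
  finally have "p\<^sup>2 * (k + 1) / k\<^sup>2 \<le> 0" by simp
  moreover have "0 < p\<^sup>2 * (k + 1) / k\<^sup>2" using k \<open>p \<noteq> 0\<close> by (intro divide_pos_pos mult_pos_pos) simp_all
  ultimately show False by simp
qed

section \<open>Adjoint trajectories and their cost as a bilinear form\<close>

text \<open>One column of the dual recursion, with a row of \<open>K\<close> as \<open>k\<close>.
  Taking \<open>k = 0\<close> gives the differences of feasible trajectories.\<close>

primrec adjoint_state :: "real^'n^'n \<Rightarrow> real^'n^'m \<Rightarrow> real^'n \<Rightarrow> (nat \<Rightarrow> real^'m) \<Rightarrow> nat \<Rightarrow> real^'n" where
  "adjoint_state A C k a 0 = k + transpose C *v a 0"
| "adjoint_state A C k a (Suc i) = transpose A *v adjoint_state A C k a i + transpose C *v a (Suc i)"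

definition adjoint_traj :: "real^'n^'n \<Rightarrow> real^'n^'m \<Rightarrow> real^'n \<Rightarrow> (nat \<Rightarrow> real^'m) \<Rightarrow> nat \<Rightarrow> (real^'n) \<times> (real^'m)" where
  "adjoint_traj A C k a i = (adjoint_state A C k a i, a i)"

text \<open>The polarised cost of a single column, so that optimality can be stated as
  orthogonality. Pairing state and control makes a trajectory one vector. The form ignores all
  indices beyond \<open>t\<close>, hence is degenerate even for definite covariances. It reappears
  as the variance of noise combinations.\<close>

definition cost_form :: "real^'n^'n \<Rightarrow> real^'n^'n \<Rightarrow> real^'m^'m \<Rightarrow> nat \<Rightarrow>
    (nat \<Rightarrow> (real^'n) \<times> (real^'m)) \<Rightarrow> (nat \<Rightarrow> (real^'n) \<times> (real^'m)) \<Rightarrow> real" where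
  "cost_form S0 Q R t f g =
    fst (f t) \<bullet> (S0 *v fst (g t)) + snd (f t) \<bullet> (R *v snd (g t))
    + (\<Sum>i<t. fst (f i) \<bullet> (Q *v fst (g i)) + snd (f i) \<bullet> (R *v snd (g i)))"

lemma cost_form_add: "cost_form S0 Q R t (\<lambda>i. f i + g i) h = cost_form S0 Q R t f h + cost_form S0 Q R t g h"
  by (simp add: cost_form_def inner_add_left sum.distrib)

lemma cost_form_scaleR: "cost_form S0 Q R t (\<lambda>i. c *\<^sub>R f i) h = c * cost_form S0 Q R t f h"
  by (simp add: cost_form_def distrib_left sum_distrib_left)

lemma cost_form_add_right: "cost_form S0 Q R t h (\<lambda>i. f i + g i) = cost_form S0 Q R t h f + cost_form S0 Q R t h g"
  by (simp add: cost_form_def inner_add_right matrix_vector_right_distrib sum.distrib)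

lemma cost_form_scaleR_right: "cost_form S0 Q R t h (\<lambda>i. c *\<^sub>R f i) = c * cost_form S0 Q R t h f"
  by (simp add: cost_form_def matrix_vector_mult_scaleR distrib_left sum_distrib_left)

lemma inner_psd_commute: "psd S \<Longrightarrow> v \<bullet> (S *v w) = w \<bullet> (S *v v)"
  by (metis dot_lmul_matrix inner_commute psd_def transpose_matrix_vector)

lemma cost_form_commute:
  "psd S0 \<Longrightarrow> psd Q \<Longrightarrow> psd R \<Longrightarrow> cost_form S0 Q R t f g = cost_form S0 Q R t g f"
  unfolding cost_form_def by (simp add: inner_psd_commute[of _ "fst (f _)"] inner_psd_commute[of _ "snd (f _)"])

lemma cost_form_nonneg: "psd S0 \<Longrightarrow> psd Q \<Longrightarrow> psd R \<Longrightarrow> 0 \<le> cost_form S0 Q R t f f"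
  unfolding cost_form_def by (intro add_nonneg_nonneg sum_nonneg) (auto simp: psd_def)

lemma cost_form_cong:
  "(\<And>i. i \<le> t \<Longrightarrow> f i = f' i) \<Longrightarrow> (\<And>i. i \<le> t \<Longrightarrow> g i = g' i) \<Longrightarrow> cost_form S0 Q R t f g = cost_form S0 Q R t f' g'"
  by (simp add: cost_form_def)

lemma adjoint_state_add:
  "adjoint_state A C (k + k') (\<lambda>i. a i + a' i) i = adjoint_state A C k a i + adjoint_state A C k' a' i"
  by (induction i) (simp_all add: matrix_vector_right_distrib)

lemma adjoint_state_scaleR:
  "adjoint_state A C (c *\<^sub>R k) (\<lambda>i. c *\<^sub>R a i) i = c *\<^sub>R adjoint_state A C k a i"
  by (induction i) (simp_all add: scaleR_matrix_vector_assoc matrix_vector_mult_scaleR scaleR_add_right)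

lemma adjoint_traj_add:
  "adjoint_traj A C (k + k') (\<lambda>i. a i + a' i) i = adjoint_traj A C k a i + adjoint_traj A C k' a' i"
  by (simp add: adjoint_traj_def adjoint_state_add)

lemma adjoint_traj_scaleR:
  "adjoint_traj A C (c *\<^sub>R k) (\<lambda>i. c *\<^sub>R a i) i = c *\<^sub>R adjoint_traj A C k a i"
  by (simp add: adjoint_traj_def adjoint_state_scaleR)

lemma adjoint_traj_0: "adjoint_traj A C 0 (\<lambda>_. 0) i = 0"
  using adjoint_traj_scaleR[of A C 0 0 "\<lambda>_. 0" i] by simp

lemma adjoint_traj_sum:
  assumes "finite X"
  shows "adjoint_traj A C 0 (\<lambda>i. \<Sum>x\<in>X. c x *\<^sub>R a x i) i = (\<Sum>x\<in>X. c x *\<^sub>R adjoint_traj A C 0 (a x) i)"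
  using assms
proof induction
  case (insert x X)
  then show ?case
    using adjoint_traj_add[of A C 0 0 "\<lambda>i. c x *\<^sub>R a x i" "\<lambda>i. \<Sum>x\<in>X. c x *\<^sub>R a x i" i]
      adjoint_traj_scaleR[of A C "c x" 0 "a x" i] by simp
qed (simp add: adjoint_traj_0)

lemma adjoint_state_cong: "(\<And>j. j \<le> i \<Longrightarrow> a j = a' j) \<Longrightarrow> adjoint_state A C k a i = adjoint_state A C k a' i"
  by (induction i) simp_all

lemma cost_form_sum:
  assumes "finite X"
  shows "cost_form S0 Q R t (\<lambda>i. \<Sum>x\<in>X. c x *\<^sub>R f x i) h = (\<Sum>x\<in>X. c x * cost_form S0 Q R t (f x) h)"
  using assms
proof induction
  case (insert x X)
  then show ?case by (simp add: cost_form_add cost_form_scaleR)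
qed (simp add: cost_form_def)

text \<open>Correct the trajectory of the zero control by its projection onto the variations. Up to
  time \<open>t\<close> these are spanned by finitely many unit impulses, so the projection for
  degenerate forms applies.\<close>

lemma ex_orthogonal_control:
  fixes A :: "real^'n^'n" and C :: "real^'n^'m"
  assumes psd: "psd S0" "psd Q" "psd R"
  shows "\<exists>a. \<forall>d. cost_form S0 Q R t (adjoint_traj A C k a) (adjoint_traj A C 0 d) = 0"
proof -
  \<comment> \<open>The impulse at time \<open>fst x\<close> in coordinate
    \<open>snd x\<close>.\<close>
  define \<delta> :: "nat \<times> 'm \<Rightarrow> nat \<Rightarrow> real^'m" where "\<delta> x i = (if i = fst x then axis (snd x) 1 else 0)" for x i
  let ?X = "{..t} \<times> (UNIV :: 'm set)"
  let ?S = "range (adjoint_traj A C 0)"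
  have "\<exists>q\<in>?S. (\<forall>d\<in>(\<lambda>x. adjoint_traj A C 0 (\<delta> x)) ` ?X. cost_form S0 Q R t (\<lambda>i. adjoint_traj A C k (\<lambda>_. 0) i + q i) d = 0)
      \<and> (\<forall>f. (\<forall>d\<in>(\<lambda>x. adjoint_traj A C 0 (\<delta> x)) ` ?X. cost_form S0 Q R t f d = 0) \<longrightarrow> cost_form S0 Q R t f q = 0)"
  proof (rule psd_form_projection)
    fix f g c assume "f \<in> ?S" "g \<in> ?S"
    then obtain a d where "f = adjoint_traj A C 0 a" "g = adjoint_traj A C 0 d" by auto
    then have "(\<lambda>i. f i + g i) = adjoint_traj A C 0 (\<lambda>i. a i + d i)"
      using adjoint_traj_add[of A C 0 0 a d] by auto
    then show "(\<lambda>i. f i + g i) \<in> ?S" by simp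
  next
    fix f c assume "f \<in> ?S"
    then obtain a where "f = adjoint_traj A C 0 a" by auto
    then have "(\<lambda>i. c *\<^sub>R f i) = adjoint_traj A C 0 (\<lambda>i. c *\<^sub>R a i)"
      using adjoint_traj_scaleR[of A C c 0 a] by auto
    then show "(\<lambda>i. c *\<^sub>R f i) \<in> ?S" by simp
  next
    have "(\<lambda>_. 0) = adjoint_traj A C 0 (\<lambda>_. 0)" using adjoint_traj_0[of A C] by auto
    then show "(\<lambda>_. 0) \<in> ?S" by (metis rangeI)
  qed (auto simp: cost_form_add cost_form_scaleR cost_form_nonneg psd intro: cost_form_commute[OF psd])
  then obtain a where a: "\<And>x. x \<in> ?X \<Longrightarrow>
      cost_form S0 Q R t (\<lambda>i. adjoint_traj A C k (\<lambda>_. 0) i + adjoint_traj A C 0 a i) (adjoint_traj A C 0 (\<delta> x)) = 0"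
    by blast
  have ka: "(\<lambda>i. adjoint_traj A C k (\<lambda>_. 0) i + adjoint_traj A C 0 a i) = adjoint_traj A C k a"
    using adjoint_traj_add[of A C k 0 "\<lambda>_. 0" a] by auto
  have "cost_form S0 Q R t (adjoint_traj A C k a) (adjoint_traj A C 0 d) = 0" for d
  proof -
    \<comment> \<open>This agrees with \<open>d\<close> only up to time \<open>t\<close>, which is
      all that the cost sees.\<close>
    let ?d = "\<lambda>i. \<Sum>x\<in>?X. (d (fst x) $ snd x) *\<^sub>R \<delta> x i"
    have "?d i = d i" if "i \<le> t" for i
    proof -
      have "?d i = (\<Sum>j\<le>t. \<Sum>l\<in>UNIV. (d j $ l) *\<^sub>R \<delta> (j, l) i)"
        by (simp add: sum.cartesian_product split_def)
      also have "\<dots> = (\<Sum>j\<le>t. if j = i then d i else 0)"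
        by (intro sum.cong refl) (auto simp: \<delta>_def vec_eq_iff axis_def if_distrib cong: if_cong)
      finally show ?thesis using that by simp
    qed
    then have "adjoint_traj A C 0 d i = (\<Sum>x\<in>?X. (d (fst x) $ snd x) *\<^sub>R adjoint_traj A C 0 (\<delta> x) i)" if "i \<le> t" for i
      using that by (subst adjoint_traj_sum[symmetric]) (auto simp: adjoint_traj_def intro: adjoint_state_cong)
    then have "cost_form S0 Q R t (adjoint_traj A C 0 d) (adjoint_traj A C k a) =
        (\<Sum>x\<in>?X. (d (fst x) $ snd x) * cost_form S0 Q R t (adjoint_traj A C 0 (\<delta> x)) (adjoint_traj A C k a))"
      by (subst cost_form_sum[symmetric]) (auto intro: cost_form_cong)
    also have "\<dots> = 0"
      using a unfolding ka by (intro sum.neutral) (simp add: cost_form_commute[OF psd, of _ _ "adjoint_traj A C k a"])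
    finally show ?thesis by (simp add: cost_form_commute[OF psd, of _ "adjoint_traj A C k a"])
  qed
  then show ?thesis by blast
qed

text \<open>Along \<open>a + r d\<close> the cost is a quadratic polynomial in \<open>r\<close>
  whose linear coefficient is twice the form against the variation. Controls form a vector space, so
  every competitor is reached with \<open>r = 1\<close>.\<close>

lemma minimal_iff_orthogonal:
  assumes psd: "psd S0" "psd Q" "psd R"
  shows "(\<forall>a'. cost_form S0 Q R t (adjoint_traj A C k a) (adjoint_traj A C k a)
            \<le> cost_form S0 Q R t (adjoint_traj A C k a') (adjoint_traj A C k a'))
    \<longleftrightarrow> (\<forall>d. cost_form S0 Q R t (adjoint_traj A C k a) (adjoint_traj A C 0 d) = 0)"
    (is "?min \<longleftrightarrow> ?orth")
proof -
  let ?b = "cost_form S0 Q R t"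
  have expand: "?b (adjoint_traj A C k (\<lambda>i. a i + r *\<^sub>R d i)) (adjoint_traj A C k (\<lambda>i. a i + r *\<^sub>R d i)) =
      ?b (adjoint_traj A C k a) (adjoint_traj A C k a) + 2 * r * ?b (adjoint_traj A C k a) (adjoint_traj A C 0 d)
      + r\<^sup>2 * ?b (adjoint_traj A C 0 d) (adjoint_traj A C 0 d)" for r d
  proof -
    have "adjoint_traj A C k (\<lambda>i. a i + r *\<^sub>R d i) i = adjoint_traj A C k a i + r *\<^sub>R adjoint_traj A C 0 d i" for i
      using adjoint_traj_add[of A C k 0 a "\<lambda>i. r *\<^sub>R d i" i] adjoint_traj_scaleR[of A C r 0 d i] by simp
    then have "adjoint_traj A C k (\<lambda>i. a i + r *\<^sub>R d i) = (\<lambda>i. adjoint_traj A C k a i + r *\<^sub>R adjoint_traj A C 0 d i)"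
      by (rule ext)
    then show ?thesis
      by (simp add: cost_form_add cost_form_scaleR cost_form_add_right cost_form_scaleR_right
          cost_form_commute[OF psd, of _ "adjoint_traj A C 0 d" "adjoint_traj A C k a"] power2_eq_square distrib_left)
  qed
  show ?thesis
  proof
    assume min: ?min
    show ?orth
    proof
      fix d
      let ?p = "?b (adjoint_traj A C k a) (adjoint_traj A C 0 d)" and ?q = "?b (adjoint_traj A C 0 d) (adjoint_traj A C 0 d)"
      have q: "0 \<le> ?q" by (rule cost_form_nonneg[OF psd])
      have "0 \<le> 2 * r * ?p + r\<^sup>2 * ?q" for r
        using min[THEN spec, of "\<lambda>i. a i + r *\<^sub>R d i"] expand[of r d] by linarith
      then show "?p = 0" by (rule linear_coeff_eq_0) (rule q)
    qed
  next
    assume orth: ?orth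
    show ?min
    proof
      fix a'
      have "a' = (\<lambda>i. a i + 1 *\<^sub>R (a' i - a i))" by simp
      then show "?b (adjoint_traj A C k a) (adjoint_traj A C k a) \<le> ?b (adjoint_traj A C k a') (adjoint_traj A C k a')"
        using expand[of 1 "\<lambda>i. a' i - a i"] orth cost_form_nonneg[OF psd, of t "adjoint_traj A C 0 (\<lambda>i. a' i - a i)"] by simp
    qed
  qed
qed

section \<open>Reduction of the matrix problem to its columns\<close>

lemma column_add: "column j (M + N) = column j M + column j N"
  by (simp add: column_def vec_eq_iff)

lemma column_matrix_mult: "column j (M ** N) = M *v column j N"
  by (simp add: column_def vec_eq_iff matrix_matrix_mult_def matrix_vector_mult_def)

lemma column_eqI: "(\<And>j. column j M = column j N) \<Longrightarrow> M = N"
  by (simp add: column_def vec_eq_iff)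

lemma dual_feasible_iff:
  "dual_feasible A C K t z \<alpha> \<longleftrightarrow>
    (\<forall>i\<le>t. \<forall>j. column j (z i) = adjoint_state A C (row j K) (\<lambda>i. column j (\<alpha> i)) i)"
    (is "_ \<longleftrightarrow> (\<forall>i\<le>t. ?P i)")
proof
  assume f: "dual_feasible A C K t z \<alpha>"
  have "?P i" if "i \<le> t" for i
    using that by (induction i) (use f in \<open>simp_all add: dual_feasible_def column_add column_matrix_mult\<close>)
  then show "\<forall>i\<le>t. ?P i" by blast
next
  assume "\<forall>i\<le>t. ?P i"
  then show "dual_feasible A C K t z \<alpha>"
    by (auto simp: dual_feasible_def column_add column_matrix_mult intro!: column_eqI)
qed

lemma trace_quadratic: "trace (transpose Z ** S ** Z) = (\<Sum>j\<in>UNIV. column j Z \<bullet> (S *v column j Z))"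
proof -
  have "(transpose Z ** S ** Z) $ j $ j = column j Z \<bullet> (S *v column j Z)" for j
  proof -
    have "(transpose Z ** S ** Z) $ j $ j = (transpose Z ** (S ** Z)) $ j $ j" by (simp add: matrix_mul_assoc)
    also have "\<dots> = column j Z \<bullet> column j (S ** Z)"
      by (simp add: matrix_matrix_mult_def inner_vec_def column_def transpose_def)
    finally show ?thesis by (simp add: column_matrix_mult)
  qed
  then show ?thesis by (simp add: trace_def)
qed

lemma trace_sum: "trace (\<Sum>i\<in>I. f i) = (\<Sum>i\<in>I. trace (f i))"
  unfolding trace_def by (simp, subst sum.swap) simp

lemma dual_cost_eq:
  "dual_cost S0 Q R t z \<alpha> =
    (\<Sum>j\<in>UNIV. cost_form S0 Q R t (\<lambda>i. (column j (z i), column j (\<alpha> i))) (\<lambda>i. (column j (z i), column j (\<alpha> i))))"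
proof -
  have "(\<Sum>i<t. \<Sum>j\<in>UNIV. column j (z i) \<bullet> (Q *v column j (z i)) + column j (\<alpha> i) \<bullet> (R *v column j (\<alpha> i)))
      = (\<Sum>j\<in>UNIV. \<Sum>i<t. column j (z i) \<bullet> (Q *v column j (z i)) + column j (\<alpha> i) \<bullet> (R *v column j (\<alpha> i)))"
    by (rule sum.swap)
  then show ?thesis
    unfolding dual_cost_def cost_form_def by (simp add: trace_add trace_sum trace_quadratic sum.distrib)
qed

definition column_cost where
  "column_cost A C K S0 Q R t j a =
    cost_form S0 Q R t (adjoint_traj A C (row j K) a) (adjoint_traj A C (row j K) a)"

lemma dual_cost_feasible:
  assumes "dual_feasible A C K t z \<alpha>"
  shows "dual_cost S0 Q R t z \<alpha> = (\<Sum>j\<in>UNIV. column_cost A C K S0 Q R t j (\<lambda>i. column j (\<alpha> i)))"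
  unfolding dual_cost_eq column_cost_def
  using assms by (intro sum.cong refl cost_form_cong) (auto simp: dual_feasible_iff adjoint_traj_def)

text \<open>The constraints do not couple the columns: any choice of one control per column
  assembles into a feasible pair. This is what lets the trace be minimised column by column.\<close>

lemma ex_feasible_columns:
  fixes A :: "real^'n^'n" and C :: "real^'n^'m" and K :: "real^'n^'p" and a :: "'p \<Rightarrow> nat \<Rightarrow> real^'m"
  shows "\<exists>z \<alpha>. dual_feasible A C K t z \<alpha> \<and> (\<forall>j i. column j (\<alpha> i) = a j i)"
proof -
  define \<alpha> :: "nat \<Rightarrow> real^'p^'m" where "\<alpha> i = (\<chi> r j. a j i $ r)" for i
  define z :: "nat \<Rightarrow> real^'p^'n" where "z i = (\<chi> r j. adjoint_state A C (row j K) (a j) i $ r)" for i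
  have "column j (\<alpha> i) = a j i" "column j (z i) = adjoint_state A C (row j K) (a j) i" for i j
    by (simp_all add: \<alpha>_def z_def column_def vec_eq_iff)
  then show ?thesis unfolding dual_feasible_iff by (intro exI[of _ z] exI[of _ \<alpha>]) simp
qed

text \<open>The cost is a sum over columns that vary freely, so it is minimal exactly when each
  summand is. For the forward direction only column \<open>j\<close> is exchanged and the other
  summands cancel.\<close>

lemma dual_solution_iff:
  assumes psd: "psd S0" "psd Q" "psd R"
  shows "dual_solution A C K S0 Q R t z \<alpha> \<longleftrightarrow> dual_feasible A C K t z \<alpha> \<and>
    (\<forall>j d. cost_form S0 Q R t (adjoint_traj A C (row j K) (\<lambda>i. column j (\<alpha> i))) (adjoint_traj A C 0 d) = 0)"
proof -
  let ?c = "column_cost A C K S0 Q R t"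
  have "(\<forall>z' \<alpha>'. dual_feasible A C K t z' \<alpha>' \<longrightarrow> dual_cost S0 Q R t z \<alpha> \<le> dual_cost S0 Q R t z' \<alpha>')
      \<longleftrightarrow> (\<forall>j a. ?c j (\<lambda>i. column j (\<alpha> i)) \<le> ?c j a)" (is "?L \<longleftrightarrow> ?R")
    if f: "dual_feasible A C K t z \<alpha>"
  proof
    assume L: ?L
    show ?R
    proof (intro allI)
      fix j a
      obtain z' \<alpha>' where f': "dual_feasible A C K t z' \<alpha>'"
        and col: "\<And>l i. column l (\<alpha>' i) = (if l = j then a i else column l (\<alpha> i))"
        using ex_feasible_columns[of A C K t "\<lambda>l i. if l = j then a i else column l (\<alpha> i)"] by blast
      have "dual_cost S0 Q R t z \<alpha> \<le> dual_cost S0 Q R t z' \<alpha>'" using L f' by blast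
      then show "?c j (\<lambda>i. column j (\<alpha> i)) \<le> ?c j a"
        unfolding dual_cost_feasible[OF f] dual_cost_feasible[OF f'] col
        by (simp add: sum.remove[of UNIV j])
    qed
  next
    assume ?R
    then show ?L by (auto simp: dual_cost_feasible[OF f] dual_cost_feasible intro!: sum_mono)
  qed
  then show ?thesis
    unfolding dual_solution_def minimal_iff_orthogonal[OF psd, symmetric] column_cost_def by blast
qed

lemma ex_dual_solution:
  assumes psd: "psd S0" "psd Q" "psd R"
  shows "\<exists>z \<alpha>. dual_solution A C K S0 Q R t z \<alpha>"
proof -
  have "\<exists>a. \<forall>d. cost_form S0 Q R t (adjoint_traj A C (row j K) a) (adjoint_traj A C 0 d) = 0" for j
    by (rule ex_orthogonal_control[OF psd])
  then obtain a where a: "\<And>j d. cost_form S0 Q R t (adjoint_traj A C (row j K) (a j)) (adjoint_traj A C 0 d) = 0"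
    by metis
  obtain z \<alpha> where "dual_feasible A C K t z \<alpha>" "\<And>j i. column j (\<alpha> i) = a j i"
    using ex_feasible_columns[of A C K t a] by blast
  then show ?thesis using a unfolding dual_solution_iff[OF psd] by (intro exI[of _ z] exI[of _ \<alpha>]) simp
qed

lemma dual_value_eq:
  "dual_solution A C K S0 Q R t z \<alpha> \<Longrightarrow> dual_value A C K S0 Q R t = dual_cost S0 Q R t z \<alpha>"
  unfolding dual_value_def dual_solution_def by (intro cInf_eq_minimum) auto

section \<open>Gaussian noises\<close>

text \<open>With the centred initial state as \<open>X0\<close> this is linear in the noises and
  free of inputs. The true state differs from it by a deterministic recursion in the inputs.\<close>

primrec centred_state :: "real^'n^'n \<Rightarrow> ('a \<Rightarrow> real^'n) \<Rightarrow> (nat \<Rightarrow> 'a \<Rightarrow> real^'n) \<Rightarrow> nat \<Rightarrow> 'a \<Rightarrow> real^'n" where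
  "centred_state A X0 \<xi> 0 s = X0 s"
| "centred_state A X0 \<xi> (Suc i) s = A *v centred_state A X0 \<xi> i s + \<xi> i s"

text \<open>Summation by parts backwards in time: adjoint index \<open>i\<close> belongs to time
  \<open>t - i\<close>, and each step moves \<open>A\<close> across the inner product. The term
  \<open>transpose C *v a i\<close> in the adjoint is compensated by \<open>W - Y\<close>, which is
  minus \<open>C *v X\<close>. Only \<open>j = t\<close> is used later. The driving term
  \<open>V\<close> is left open because it will be the process noise alone or the noise together
  with the input.\<close>

lemma adjoint_telescope:
  fixes X V :: "nat \<Rightarrow> real^'n" and Y W :: "nat \<Rightarrow> real^'m"
  assumes X: "\<And>i. X (Suc i) = A *v X i + V i" and Y: "\<And>i. Y i = C *v X i + W i" and "j \<le> t"
  shows "k \<bullet> X t = adjoint_state A C k a j \<bullet> X (t - j)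
    + (\<Sum>i<j. adjoint_state A C k a i \<bullet> V (t - Suc i)) + (\<Sum>i\<le>j. a i \<bullet> (W (t - i) - Y (t - i)))"
  using \<open>j \<le> t\<close>
proof (induction j)
  case 0
  then show ?case by (simp add: Y inner_add_left transpose_matrix_vector dot_lmul_matrix)
next
  case (Suc j)
  then have "t - j = Suc (t - Suc j)" by simp
  then have "X (t - j) = A *v X (t - Suc j) + V (t - Suc j)" by (metis X)
  with Suc show ?case
    by (simp add: Y inner_add_left inner_add_right transpose_matrix_vector dot_lmul_matrix)
qed

text \<open>The estimation error when \<open>f\<close> is an adjoint trajectory. Allowing arbitrary
  \<open>f\<close> makes it linear in \<open>f\<close>, so rescaling and adding variations stay
  within the same family.\<close>

definition noise_combination ::
    "('a \<Rightarrow> real^'n) \<Rightarrow> (nat \<Rightarrow> 'a \<Rightarrow> real^'n) \<Rightarrow> (nat \<Rightarrow> 'a \<Rightarrow> real^'m) \<Rightarrow> nat \<Rightarrow>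
     (nat \<Rightarrow> (real^'n) \<times> (real^'m)) \<Rightarrow> 'a \<Rightarrow> real" where
  "noise_combination X0 \<xi> w t f s =
    fst (f t) \<bullet> X0 s + (\<Sum>i<t. fst (f i) \<bullet> \<xi> (t - Suc i) s) + (\<Sum>i\<le>t. snd (f i) \<bullet> w (t - i) s)"

lemma noise_combination_scaleR:
  "noise_combination X0 \<xi> w t (\<lambda>i. r *\<^sub>R f i) s = r * noise_combination X0 \<xi> w t f s"
  by (simp add: noise_combination_def distrib_left sum_distrib_left)

lemma noise_combination_add:
  "noise_combination X0 \<xi> w t (\<lambda>i. f i + g i) s = noise_combination X0 \<xi> w t f s + noise_combination X0 \<xi> w t g s"
  by (simp add: noise_combination_def inner_add_left sum.distrib)

text \<open>For \<open>k = 0\<close> the left-hand side of the telescoped identity vanishes. Hence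
  the variations correspond exactly to linear functionals of the centred outputs, and orthogonality
  to them to lack of correlation with these outputs.\<close>

lemma noise_combination_variation:
  assumes Y: "\<And>i. Y i = C *v centred_state A X0 \<xi> i s + w i s"
  shows "noise_combination X0 \<xi> w t (adjoint_traj A C 0 d) s = (\<Sum>i\<le>t. d i \<bullet> Y (t - i))"
  using adjoint_telescope[of "\<lambda>i. centred_state A X0 \<xi> i s" A "\<lambda>i. \<xi> i s", OF centred_state.simps(2) Y order_refl, of 0 t d]
  by (simp add: noise_combination_def adjoint_traj_def inner_diff_right sum_subtractf)

lemma borel_measurable_noise_combination [measurable]:
  assumes [measurable]: "X0 \<in> borel_measurable M" "\<And>i. \<xi> i \<in> borel_measurable M" "\<And>i. w i \<in> borel_measurable M"
  shows "noise_combination X0 \<xi> w t f \<in> borel_measurable M"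
  unfolding noise_combination_def[abs_def] by measurable

lemma borel_measurable_matrix_vector_mult [measurable (raw)]:
  fixes A :: "real^'n^'m"
  assumes "f \<in> borel_measurable M"
  shows "(\<lambda>s. A *v f s) \<in> borel_measurable M"
  by (rule measurable_compose[OF assms])
     (intro borel_measurable_continuous_onI matrix_vector_mult_linear_continuous_on)

lemma borel_measurable_centred_state:
  assumes [measurable]: "X0 \<in> borel_measurable M" "\<And>i. \<xi> i \<in> borel_measurable M"
  shows "centred_state A X0 \<xi> i \<in> borel_measurable M"
proof (induction i)
  case (Suc i)
  note [measurable] = Suc
  show ?case unfolding centred_state.simps[abs_def] by measurable
qed simp

lemma rv_events_compose:
  fixes h :: "'b::topological_space \<Rightarrow> 'c::topological_space"
  assumes "h \<in> borel_measurable borel"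
  shows "{(\<lambda>s. h (X s)) -` S \<inter> space M |S. S \<in> sets borel} \<subseteq> rv_events M X"
proof safe
  fix S :: "'c set" assume "S \<in> sets borel"
  then have "h -` S \<in> sets borel" using measurable_sets[OF assms] by simp
  moreover have "(\<lambda>s. h (X s)) -` S \<inter> space M = X -` (h -` S) \<inter> space M" by auto
  ultimately show "(\<lambda>s. h (X s)) -` S \<inter> space M \<in> rv_events M X" unfolding rv_events_def by blast
qed

lemma (in prob_space) gaussian_vector_expectation_cis:
  assumes "gaussian_vector M X \<mu> S"
  shows "(CLINT s|M. cis (a \<bullet> (X s - \<mu>))) = exp (- (a \<bullet> (S *v a)) / 2)"
proof -
  have [measurable]: "X \<in> borel_measurable M" and S: "0 \<le> a \<bullet> (S *v a)"
    and d: "distr M borel (\<lambda>s. a \<bullet> X s) = normal_law (a \<bullet> \<mu>) (a \<bullet> (S *v a))"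
    using assms by (auto simp: gaussian_vector_def psd_def)
  have "(CLINT s|M. cis (a \<bullet> (X s - \<mu>))) = (CLINT s|M. cis (- (a \<bullet> \<mu>)) * cis (1 * (a \<bullet> X s)))"
    by (simp add: cis_mult inner_diff_right)
  also have "\<dots> = cis (- (a \<bullet> \<mu>)) * (CLINT s|M. cis (1 * (a \<bullet> X s)))"
    by (rule integral_mult_right_zero)
  also have "(CLINT s|M. cis (1 * (a \<bullet> X s))) = cis (a \<bullet> \<mu>) * exp (- (a \<bullet> (S *v a)) / 2)"
    by (subst expectation_cis_normal_law[OF _ S d]) simp_all
  finally show ?thesis by (simp add: cis_mult mult.assoc[symmetric])
qed

section \<open>Joint characteristic function of the independent sources\<close>

locale gaussian_noises = prob_space M for M :: "'a measure" +
  fixes G :: "'a measure" and x0 :: "'a \<Rightarrow> real^'n" and \<xi> :: "nat \<Rightarrow> 'a \<Rightarrow> real^'n"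
    and w :: "nat \<Rightarrow> 'a \<Rightarrow> real^'m" and xhat0 :: "real^'n" and \<Sigma>0 Q :: "real^'n^'n" and R :: "real^'m^'m"
  assumes gaussian_x0: "gaussian_vector M x0 xhat0 \<Sigma>0"
    and gaussian_\<xi>: "\<And>i. gaussian_vector M (\<xi> i) 0 Q"
    and gaussian_w: "\<And>i. gaussian_vector M (w i) 0 R"
    and subalgebra_G: "subalgebra M G"
    and indep_sources: "indep_sets (source_events M x0 \<xi> w G) UNIV"
begin

abbreviation "X0 \<equiv> \<lambda>s. x0 s - xhat0"
abbreviation "noise \<equiv> noise_combination X0 \<xi> w"
abbreviation "cost \<equiv> cost_form \<Sigma>0 Q R"

lemma measurable_sources [measurable]:
  "x0 \<in> borel_measurable M" "\<xi> i \<in> borel_measurable M" "w i \<in> borel_measurable M"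
  using gaussian_x0 gaussian_\<xi> gaussian_w by (auto simp: gaussian_vector_def)

lemma psd_covariances: "psd \<Sigma>0" "psd Q" "psd R"
  using gaussian_x0 gaussian_\<xi> gaussian_w by (auto simp: gaussian_vector_def)

lemma noise_measurable [measurable]: "noise t f \<in> borel_measurable M"
  by (rule borel_measurable_noise_combination) measurable

text \<open>The sources have different dimensions and \<open>G\<close> is only a sigma-algebra.
  Phases, and the indicator of one event of \<open>G\<close>, turn all of them into complex
  variables whose generated events stay within those of the sources, so expectations of products
  will factor.\<close>

lemma indep_vars_phases:
  assumes G0: "G0 \<in> sets G"
  shows "indep_vars (\<lambda>_. borel) (case_source (\<lambda>s. cis (a \<bullet> X0 s)) (\<lambda>i s. cis (p i \<bullet> \<xi> i s))
      (\<lambda>i s. cis (q i \<bullet> w i s)) (\<lambda>s. indicator G0 s :: complex)) I"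
    (is "indep_vars _ ?Z I")
proof -
  have sub: "{?Z k -` S \<inter> space M |S. S \<in> sets borel} \<subseteq> source_events M x0 \<xi> w G k" for k
  proof (cases k)
    case Exogenous
    have "(\<lambda>s. indicator G0 s :: complex) \<in> borel_measurable G" using G0 by measurable
    from measurable_sets[OF this] show ?thesis
      using Exogenous subalgebra_G by (auto simp: subalgebra_def)
  next
    case Initial
    then show ?thesis using rv_events_compose[of "\<lambda>v. cis (a \<bullet> (v - xhat0))" x0 M] by (simp add: cis_conv_exp)
  next
    case (Process i)
    then show ?thesis using rv_events_compose[of "\<lambda>v. cis (p i \<bullet> v)" "\<xi> i" M] by (simp add: cis_conv_exp)
  next
    case (Measurement i)
    then show ?thesis using rv_events_compose[of "\<lambda>v. cis (q i \<bullet> v)" "w i" M] by (simp add: cis_conv_exp)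
  qed
  have G0M [measurable]: "G0 \<in> sets M" using G0 subalgebra_G by (auto simp: subalgebra_def)
  show ?thesis
    unfolding indep_vars_def2
  proof (intro conjI ballI)
    show "?Z k \<in> borel_measurable M" for k
      by (cases k) (simp_all add: cis_conv_exp)
    show "indep_sets (\<lambda>k. {?Z k -` S \<inter> space M |S. S \<in> sets borel}) I"
      by (rule indep_sets_mono[OF indep_sources _ sub]) simp
  qed
qed

text \<open>The phase of a sum is the product of phases of independent sources. Each contributes the
  exponential of minus half its own variance, and these variances add up to the cost.\<close>

lemma expectation_indicator_cis_noise:
  assumes G0: "G0 \<in> sets G"
  shows "(CLINT s|M. indicator G0 s * cis (noise t f s)) = prob G0 * exp (- cost t f f / 2)"
proof -
  have G0M [measurable]: "G0 \<in> sets M" using G0 subalgebra_G by (auto simp: subalgebra_def)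
  \<comment> \<open>Sources are indexed by physical time whereas \<open>f\<close> runs backwards:
    process noise \<open>i\<close> enters the state at time \<open>i + 1\<close>, hence the weight
    \<open>t - Suc i\<close>, while measurement noise \<open>i\<close> gets
    \<open>t - i\<close>.\<close>
  define Z where "Z = case_source (\<lambda>s. cis (fst (f t) \<bullet> X0 s)) (\<lambda>i s. cis (fst (f (t - Suc i)) \<bullet> \<xi> i s))
      (\<lambda>i s. cis (snd (f (t - i)) \<bullet> w i s)) (\<lambda>s. indicator G0 s :: complex)"
  define I where "I = insert Exogenous (insert Initial (Process ` {..<t} \<union> Measurement ` {..t}))"
  have indep: "indep_vars (\<lambda>_. borel) Z I"
    unfolding Z_def by (rule indep_vars_phases[OF G0])
  have prod_I: "(\<Prod>k\<in>I. h k) = h Exogenous * h Initial * (\<Prod>i<t. h (Process i)) * (\<Prod>i\<le>t. h (Measurement i))"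
    for h :: "source \<Rightarrow> complex"
  proof -
    have "(\<Prod>k\<in>I. h k) = h Exogenous * (h Initial * ((\<Prod>k\<in>Process ` {..<t}. h k) * (\<Prod>k\<in>Measurement ` {..t}. h k)))"
      unfolding I_def by (subst prod.insert, simp, force)+ (subst prod.union_disjoint, auto)
    then show ?thesis by (simp add: prod.reindex inj_on_def mult.assoc)
  qed
  have cis_sum: "cis (sum h J) = (\<Prod>j\<in>J. cis (h j))" if "finite J" for h and J :: "nat set"
    using that by induction (simp_all add: cis_mult[symmetric])
  have noise_eq: "noise t f s = fst (f t) \<bullet> X0 s + (\<Sum>i<t. fst (f (t - Suc i)) \<bullet> \<xi> i s)
      + (\<Sum>i\<le>t. snd (f (t - i)) \<bullet> w i s)" for s
  proof -
    have "(\<Sum>i<t. fst (f i) \<bullet> \<xi> (t - Suc i) s) = (\<Sum>i<t. fst (f (t - Suc i)) \<bullet> \<xi> i s)"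
      by (subst sum.nat_diff_reindex[symmetric]) simp
    moreover have "(\<Sum>i\<le>t. snd (f i) \<bullet> w (t - i) s) = (\<Sum>i\<le>t. snd (f (t - i)) \<bullet> w i s)"
      using sum.nat_diff_reindex[of "\<lambda>i. snd (f i) \<bullet> w (t - i) s" "Suc t"] by (simp add: lessThan_Suc_atMost)
    ultimately show ?thesis by (simp add: noise_combination_def)
  qed
  have ind: "(CLINT s|M. indicator G0 s) = complex_of_real (prob G0)"
  proof -
    have "(CLINT s|M. indicator G0 s) = (CLINT s|M. complex_of_real (indicator G0 s))"
      by (intro Bochner_Integration.integral_cong refl) (simp split: split_indicator)
    then show ?thesis by (simp add: sets.Int_space_eq2[OF G0M])
  qed
  have "indicator G0 s * cis (noise t f s) = (\<Prod>k\<in>I. Z k s)" for s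
    by (simp add: prod_I Z_def noise_eq cis_sum cis_mult[symmetric] mult.assoc)
  then have "(CLINT s|M. indicator G0 s * cis (noise t f s)) = (CLINT s|M. (\<Prod>k\<in>I. Z k s))"
    by simp
  also have "\<dots> = (\<Prod>k\<in>I. (CLINT s|M. Z k s))"
  proof (rule indep_vars_lebesgue_integral[OF _ indep])
    show "integrable M (Z k)" for k
    proof (rule integrable_const_bound[where B = 1])
      show "Z k \<in> borel_measurable M" by (cases k) (simp_all add: Z_def cis_conv_exp)
      show "AE s in M. norm (Z k s) \<le> 1" by (cases k) (auto simp: Z_def split: split_indicator)
    qed
  qed (simp add: I_def)
  also have "(\<Prod>k\<in>I. (CLINT s|M. Z k s)) = prob G0 * exp (- (fst (f t) \<bullet> (\<Sigma>0 *v fst (f t))) / 2)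
      * (\<Prod>i<t. exp (- (fst (f (t - Suc i)) \<bullet> (Q *v fst (f (t - Suc i)))) / 2))
      * (\<Prod>i\<le>t. exp (- (snd (f (t - i)) \<bullet> (R *v snd (f (t - i)))) / 2))"
    using ind gaussian_vector_expectation_cis[OF gaussian_x0] gaussian_vector_expectation_cis[OF gaussian_\<xi>]
      gaussian_vector_expectation_cis[OF gaussian_w]
    by (simp add: prod_I Z_def G0M)
  also have "\<dots> = prob G0 * exp (- (fst (f t) \<bullet> (\<Sigma>0 *v fst (f t))) / 2
      + (\<Sum>i<t. - (fst (f (t - Suc i)) \<bullet> (Q *v fst (f (t - Suc i)))) / 2)
      + (\<Sum>i\<le>t. - (snd (f (t - i)) \<bullet> (R *v snd (f (t - i)))) / 2))"
    by (simp only: exp_add exp_sum finite_lessThan finite_atMost of_real_mult of_real_prod mult.assoc)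
  also have "- (fst (f t) \<bullet> (\<Sigma>0 *v fst (f t))) / 2
      + (\<Sum>i<t. - (fst (f (t - Suc i)) \<bullet> (Q *v fst (f (t - Suc i)))) / 2)
      + (\<Sum>i\<le>t. - (snd (f (t - i)) \<bullet> (R *v snd (f (t - i)))) / 2) = - cost t f f / 2"
  proof -
    have "(\<Sum>i<t. - (fst (f (t - Suc i)) \<bullet> (Q *v fst (f (t - Suc i)))) / 2) = (\<Sum>i<t. - (fst (f i) \<bullet> (Q *v fst (f i))) / 2)"
      using sum.nat_diff_reindex[of "\<lambda>i. - (fst (f i) \<bullet> (Q *v fst (f i))) / 2"] by simp
    moreover have "(\<Sum>i\<le>t. - (snd (f (t - i)) \<bullet> (R *v snd (f (t - i)))) / 2)
        = (\<Sum>i<t. - (snd (f i) \<bullet> (R *v snd (f i))) / 2) - (snd (f t) \<bullet> (R *v snd (f t))) / 2"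
      using sum.nat_diff_reindex[of "\<lambda>i. - (snd (f i) \<bullet> (R *v snd (f i))) / 2" "Suc t"] by (simp add: lessThan_Suc_atMost[symmetric])
    ultimately show ?thesis
      by (simp add: cost_form_def sum.distrib sum_negf sum_divide_distrib[symmetric] field_simps)
  qed
  finally show ?thesis .
qed

text \<open>The real form of the previous formula, obtained after a rotation by
  \<open>cis c\<close>. The free phase \<open>c\<close> covers sines as well, as the exchange of
  cosines for indicators demands.\<close>

lemma expectation_indicator_cos_noise:
  assumes G0: "G0 \<in> sets G"
  shows "(LINT s|M. indicator G0 s * cos (noise t f s + c)) = prob G0 * cos c * exp (- cost t f f / 2)"
proof -
  have G0M [measurable]: "G0 \<in> sets M" using G0 subalgebra_G by (auto simp: subalgebra_def)
  have [measurable]: "(\<lambda>s. indicator G0 s * cis (noise t f s)) \<in> borel_measurable M"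
    by (simp add: cis_conv_exp)
  have "integrable M (\<lambda>s. indicator G0 s * cis (noise t f s))"
    by (rule integrable_const_bound[where B = 1]) (auto intro!: AE_I2 split: split_indicator)
  then have int: "integrable M (\<lambda>s. cis c * (indicator G0 s * cis (noise t f s)))" by simp
  have "(LINT s|M. indicator G0 s * cos (noise t f s + c)) = (LINT s|M. Re (cis c * (indicator G0 s * cis (noise t f s))))"
    by (intro Bochner_Integration.integral_cong refl) (simp add: cos_add split: split_indicator)
  also have "\<dots> = Re (CLINT s|M. cis c * (indicator G0 s * cis (noise t f s)))"
    by (rule integral_Re[OF int])
  also have "\<dots> = Re (cis c * (prob G0 * exp (- cost t f f / 2)))"
    by (simp only: integral_mult_right_zero expectation_indicator_cis_noise[OF G0])
  finally show ?thesis by simp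
qed

lemma space_G: "space M \<in> sets G"
  using subalgebra_G by (metis sets.top subalgebra_def)

lemma distr_noise: "distr M borel (noise t f) = normal_law 0 (cost t f f)"
proof (rule distr_normal_law_if_char)
  show "0 \<le> cost t f f" by (rule cost_form_nonneg[OF psd_covariances])
  fix r
  have "cost t (\<lambda>i. r *\<^sub>R f i) (\<lambda>i. r *\<^sub>R f i) = cost t f f * r\<^sup>2"
    by (simp add: cost_form_scaleR cost_form_scaleR_right power2_eq_square)
  moreover have "(CLINT s|M. cis (r * noise t f s)) = (CLINT s|M. indicator (space M) s * cis (noise t (\<lambda>i. r *\<^sub>R f i) s))"
    by (intro Bochner_Integration.integral_cong refl) (simp add: noise_combination_scaleR)
  ultimately show "(CLINT s|M. cis (r * noise t f s)) = cis (r * 0) * exp (- cost t f f * r\<^sup>2 / 2)"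
    using expectation_indicator_cis_noise[OF space_G, of t "\<lambda>i. r *\<^sub>R f i"] by (simp add: prob_space)
qed simp

lemma noise_moments:
  "integrable M (noise t f)" "expectation (noise t f) = 0"
  "integrable M (\<lambda>s. (noise t f s)\<^sup>2)" "expectation (\<lambda>s. (noise t f s)\<^sup>2) = cost t f f"
proof -
  note m = normal_law_moments[OF cost_form_nonneg[OF psd_covariances, of t f], folded distr_noise]
  show "integrable M (noise t f)" using integrable_distr[OF noise_measurable m(1)] by simp
  show "expectation (noise t f) = 0" using m(2) by (simp add: integral_distr)
  show "integrable M (\<lambda>s. (noise t f s)\<^sup>2)" using integrable_distr[OF noise_measurable m(3)] by simp
  show "expectation (\<lambda>s. (noise t f s)\<^sup>2) = cost t f f" using m(4) by (simp add: integral_distr)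
qed

end

section \<open>Independence of an orthogonal error from the centred data\<close>

lemma borel_measurable_vecI:
  fixes f :: "'a \<Rightarrow> real^'m"
  assumes "\<And>l. (\<lambda>s. f s $ l) \<in> borel_measurable N"
  shows "f \<in> borel_measurable N"
proof (rule borel_measurable_euclidean_space[THEN iffD2], rule)
  fix v :: "real^'m" assume "v \<in> Basis"
  then obtain l where "v = axis l 1" by (auto simp: Basis_vec_def)
  then show "(\<lambda>s. f s \<bullet> v) \<in> borel_measurable N" using assms[of l] by (simp add: inner_axis)
qed

lemma sets_component_box:
  fixes Y :: "nat \<Rightarrow> 'a \<Rightarrow> real^'m" and T :: "nat \<times> 'm \<Rightarrow> real set"
  assumes Y: "\<And>i. Y i \<in> borel_measurable M" and G0: "G0 \<in> sets M" and T: "\<And>q. T q \<in> sets borel"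
  shows "{s\<in>G0. \<forall>q\<in>{..t} \<times> UNIV. Y (fst q) s $ snd q \<in> T q} \<in> sets M"
proof -
  have "{s\<in>G0. \<forall>q\<in>{..t} \<times> UNIV. Y (fst q) s $ snd q \<in> T q}
      = G0 \<inter> (\<Inter>q\<in>{..t} \<times> UNIV. (\<lambda>s. Y (fst q) s $ snd q) -` T q \<inter> space M)"
    using sets.sets_into_space[OF G0] by auto
  moreover have pre: "(\<lambda>s. Y (fst q) s $ snd q) -` T q \<inter> space M \<in> sets M" for q
    by (rule measurable_sets[OF measurable_compose[OF Y borel_measurable_nth] T])
  moreover have "(\<Inter>q\<in>{..t} \<times> UNIV. (\<lambda>s. Y (fst q) s $ snd q) -` T q \<inter> space M) \<in> sets M"
    by (rule sets.finite_INT) (simp, force, rule pre)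
  ultimately show ?thesis using G0 by (simp only: sets.Int)
qed

context gaussian_noises
begin

text \<open>The cost is the exponent of the joint characteristic function. Orthogonality makes it
  additive, so the mean of a cosine in the outputs times a cosine in the error factors, for each
  event of \<open>G\<close>. The cosine in the error becomes the indicator of \<open>S\<close>,
  after which those in the outputs become indicators of the \<open>T q\<close>.\<close>

lemma indep_orthogonal_noise_box:
  fixes A :: "real^'n^'n" and C :: "real^'n^'m" and T :: "nat \<times> 'm \<Rightarrow> real set"
  assumes orth: "\<And>d. cost t f (adjoint_traj A C 0 d) = 0"
    and Y: "\<And>i s. Y i s = C *v centred_state A X0 \<xi> i s + w i s"
    and G0: "G0 \<in> sets G" and S [measurable]: "S \<in> sets borel" and T: "\<And>q. T q \<in> sets borel"
  shows "prob ({s\<in>G0. \<forall>q\<in>{..t} \<times> UNIV. Y (fst q) s $ snd q \<in> T q} \<inter> (noise t f -` S \<inter> space M))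
    = prob {s\<in>G0. \<forall>q\<in>{..t} \<times> UNIV. Y (fst q) s $ snd q \<in> T q} * prob (noise t f -` S \<inter> space M)"
proof -
  have G0M [measurable]: "G0 \<in> sets M" using G0 subalgebra_G by (auto simp: subalgebra_def)
  have GS: "G0 \<subseteq> space M" using sets.sets_into_space[OF G0M] .
  have Ym [measurable]: "Y i \<in> borel_measurable M" for i
    unfolding Y[abs_def] using borel_measurable_centred_state[of X0 M \<xi> A i] by measurable
  let ?J = "{..t} \<times> (UNIV :: 'm set)"
  let ?v = "\<lambda>d. adjoint_traj A C 0 d"
  define p where "p = prob (noise t f -` S \<inter> space M)"
  have p_eq: "(LINT s|M. indicator S (noise t f s)) = p"
  proof -
    have "(LINT s|M. indicator S (noise t f s) :: real) = (LINT s|M. indicator (noise t f -` S \<inter> space M) s)"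
      by (intro Bochner_Integration.integral_cong refl) (auto split: split_indicator)
    then show ?thesis by (simp add: p_def)
  qed
  have p01: "0 \<le> p" "p \<le> 1" by (simp_all add: p_def)
  have int_bounded: "integrable M h" if "h \<in> borel_measurable M" "\<And>s. \<bar>h s\<bar> \<le> 1" for h :: "'a \<Rightarrow> real"
    by (rule integrable_const_bound[where B = 1]) (use that in \<open>auto intro!: AE_I2\<close>)
  have step1: "(LINT s|M. indicator G0 s * cos (noise t (?v d) s + c) * indicator S (noise t f s))
      = (LINT s|M. indicator G0 s * cos (noise t (?v d) s + c)) * p" for d c
  proof -
    \<comment> \<open>Subtracting the mean turns factorisation into the vanishing of integrals, the
      form in which cosines can be exchanged for indicators.\<close>
    define \<kappa> where "\<kappa> = (LINT s|M. indicator G0 s * cos (noise t (?v d) s + c))"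
    let ?g = "\<lambda>s. indicator G0 s * cos (noise t (?v d) s + c) :: real"
    have gle: "\<bar>?g s\<bar> \<le> 1" for s by (auto split: split_indicator)
    have "(LINT s|M. (?g s - \<kappa>) * indicator S (noise t f s)) = 0"
    proof (rule integral_mult_indicator_eq_0_if_cos[where c = "1 + \<bar>\<kappa>\<bar>"])
      show "\<bar>?g s - \<kappa>\<bar> \<le> 1 + \<bar>\<kappa>\<bar>" for s using gle[of s] by linarith
      fix r e
      let ?h = "\<lambda>q i. ?v d i + (q * r) *\<^sub>R f i"
      have h: "(LINT s|M. indicator G0 s * cos (noise t (?h q) s + (c + q * e)))
          = prob G0 * cos (c + q * e) * exp (- (cost t (?v d) (?v d) + q\<^sup>2 * r\<^sup>2 * cost t f f) / 2)" for q
      proof -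
        \<comment> \<open>Orthogonality removes the cross terms, so the cost is the same for
          \<open>q = 1\<close> and \<open>q = -1\<close>. The two cosines from the product formula
          then recombine to \<open>cos c * cos e\<close>.\<close>
        have "cost t (?h q) (?h q) = cost t (?v d) (?v d) + q\<^sup>2 * r\<^sup>2 * cost t f f"
          using orth[of d] cost_form_commute[OF psd_covariances, of t "?v d" f]
          by (simp add: cost_form_add cost_form_add_right cost_form_scaleR cost_form_scaleR_right power2_eq_square)
        then show ?thesis by (simp only: expectation_indicator_cos_noise[OF G0])
      qed
      have ih: "integrable M (\<lambda>s. indicator G0 s * cos (noise t (?h q) s + (c + q * e)))" for q
        by (rule int_bounded) (auto split: split_indicator)
      have split: "?g s * cos (r * noise t f s + e) =
          (1/2) * (indicator G0 s * cos (noise t (?h 1) s + (c + 1 * e)))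
          + (1/2) * (indicator G0 s * cos (noise t (?h (-1)) s + (c + (-1) * e)))" for s
      proof -
        have "cos a * cos b = (1/2) * cos (a + b) + (1/2) * cos (a - b)" for a b :: real
          by (simp add: cos_add cos_diff field_simps)
        note prod = this[of "noise t (?v d) s + c" "r * noise t f s + e"]
        have nh: "noise t (?h q) s = noise t (?v d) s + q * r * noise t f s" for q
          by (simp add: noise_combination_add noise_combination_scaleR)
        show ?thesis unfolding nh using prod by (simp split: split_indicator) (simp add: algebra_simps)
      qed
      have "(LINT s|M. ?g s * cos (r * noise t f s + e)) =
          (1/2) * (LINT s|M. indicator G0 s * cos (noise t (?h 1) s + (c + 1 * e)))
          + (1/2) * (LINT s|M. indicator G0 s * cos (noise t (?h (-1)) s + (c + (-1) * e)))"
        unfolding split using ih[of 1] ih[of "-1"]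
        by (subst Bochner_Integration.integral_add) (simp_all only: integrable_mult_right integral_mult_right_zero)
      also have "\<dots> = prob G0 * cos c * cos e * exp (- (cost t (?v d) (?v d) + r\<^sup>2 * cost t f f) / 2)"
        unfolding h by (simp add: cos_add cos_diff algebra_simps)
      also have "\<dots> = \<kappa> * (LINT s|M. cos (r * noise t f s + e))"
      proof -
        have "(LINT s|M. cos (r * noise t f s + e)) = (LINT s|M. indicator (space M) s * cos (noise t (\<lambda>i. r *\<^sub>R f i) s + e))"
          by (intro Bochner_Integration.integral_cong refl) (simp add: noise_combination_scaleR)
        also have "\<dots> = cos e * exp (- (r\<^sup>2 * cost t f f) / 2)"
          by (simp add: expectation_indicator_cos_noise[OF space_G] prob_space cost_form_scaleR cost_form_scaleR_right power2_eq_square)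
        finally have "(LINT s|M. cos (r * noise t f s + e)) = cos e * exp (- (r\<^sup>2 * cost t f f) / 2)" .
        moreover have "\<kappa> = prob G0 * cos c * exp (- cost t (?v d) (?v d) / 2)"
          unfolding \<kappa>_def by (rule expectation_indicator_cos_noise[OF G0])
        moreover have "exp (- (a + b) / 2) = exp (- a / 2) * exp (- b / 2)" for a b :: real
          by (simp add: exp_add[symmetric] field_simps)
        ultimately show ?thesis by (simp only: mult_ac)
      qed
      finally have 1: "(LINT s|M. ?g s * cos (r * noise t f s + e)) = \<kappa> * (LINT s|M. cos (r * noise t f s + e))" .
      have i1: "integrable M (\<lambda>s. ?g s * cos (r * noise t f s + e))"
        by (rule int_bounded) (auto intro!: abs_mult_le_bound gle simp del: abs_mult)
      have i2: "integrable M (\<lambda>s. \<kappa> * cos (r * noise t f s + e))"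
        by (intro integrable_mult_right int_bounded) auto
      have "(LINT s|M. (?g s - \<kappa>) * cos (r * noise t f s + e))
          = (LINT s|M. ?g s * cos (r * noise t f s + e) - \<kappa> * cos (r * noise t f s + e))"
        by (simp only: left_diff_distrib)
      also have "\<dots> = 0"
        by (subst Bochner_Integration.integral_diff[OF i1 i2]) (simp only: 1 integral_mult_right_zero diff_self)
      finally show "(LINT s|M. (?g s - \<kappa>) * cos (r * noise t f s + e)) = 0" .
    qed simp_all
    moreover have "(LINT s|M. (?g s - \<kappa>) * indicator S (noise t f s))
        = (LINT s|M. ?g s * indicator S (noise t f s)) - \<kappa> * p"
    proof -
      have i1: "integrable M (\<lambda>s. ?g s * indicator S (noise t f s))"
        by (rule int_bounded) (auto intro!: abs_mult_le_bound gle simp del: abs_mult split: split_indicator)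
      have i2: "integrable M (\<lambda>s. \<kappa> * indicator S (noise t f s))"
        by (intro integrable_mult_right int_bounded) (auto split: split_indicator)
      have "(LINT s|M. (?g s - \<kappa>) * indicator S (noise t f s))
          = (LINT s|M. ?g s * indicator S (noise t f s) - \<kappa> * indicator S (noise t f s))"
        by (simp only: left_diff_distrib)
      then show ?thesis
        by (subst (asm) Bochner_Integration.integral_diff[OF i1 i2]) (simp only: integral_mult_right_zero p_eq)
    qed
    ultimately show ?thesis by (simp add: \<kappa>_def)
  qed
  text \<open>The scalar error has been decoupled; now the components of the outputs are.\<close>
  define W where "W s = indicator G0 s * (indicator S (noise t f s) - p)" for s
  have [measurable]: "W \<in> borel_measurable M" unfolding W_def[abs_def] by measurable
  have "(LINT s|M. W s * (\<Prod>q\<in>?J. indicator (T q) (Y (fst q) s $ snd q))) = 0"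
  proof (rule integral_mult_prod_indicator_eq_0_if_cos[where c = 1])
    show "\<bar>W s\<bar> \<le> 1" for s using p01 by (auto simp: W_def split: split_indicator)
    fix b c
    \<comment> \<open>\<open>b\<close> is indexed by the time of the output and \<open>d\<close> by
      its distance from \<open>t\<close>.\<close>
    define d :: "nat \<Rightarrow> real^'m" where "d i = (\<chi> l. b (t - i, l))" for i
    have "(\<Sum>q\<in>?J. b q * Y (fst q) s $ snd q) = noise t (?v d) s" for s
    proof -
      have "(\<Sum>q\<in>?J. b q * Y (fst q) s $ snd q) = (\<Sum>i\<le>t. \<Sum>l\<in>UNIV. b (i, l) * Y i s $ l)"
        by (simp add: sum.cartesian_product split_def)
      also have "\<dots> = (\<Sum>i\<le>t. d (t - i) \<bullet> Y i s)"
        by (intro sum.cong refl) (simp add: inner_vec_def d_def)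
      also have "\<dots> = (\<Sum>i\<le>t. d i \<bullet> Y (t - i) s)"
        using sum.nat_diff_reindex[of "\<lambda>i. d i \<bullet> Y (t - i) s" "Suc t"] by (simp add: lessThan_Suc_atMost)
      also have "\<dots> = noise t (?v d) s"
        by (rule noise_combination_variation[OF Y, symmetric])
      finally show ?thesis .
    qed
    then have "(LINT s|M. W s * cos ((\<Sum>q\<in>?J. b q * Y (fst q) s $ snd q) + c))
        = (LINT s|M. indicator G0 s * cos (noise t (?v d) s + c) * indicator S (noise t f s)
             - p * (indicator G0 s * cos (noise t (?v d) s + c)))"
      by (intro Bochner_Integration.integral_cong refl) (simp add: W_def algebra_simps)
    also have "\<dots> = 0"
    proof (subst Bochner_Integration.integral_diff)
      show "integrable M (\<lambda>s. indicator G0 s * cos (noise t (?v d) s + c) * indicator S (noise t f s))"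
        by (rule int_bounded) (auto split: split_indicator)
      show "integrable M (\<lambda>s. p * (indicator G0 s * cos (noise t (?v d) s + c)))"
        by (intro integrable_mult_right int_bounded) (auto split: split_indicator)
    qed (simp only: step1 integral_mult_right_zero, simp)
    finally show "(LINT s|M. W s * cos ((\<Sum>q\<in>?J. b q * Y (fst q) s $ snd q) + c)) = 0" .
  qed (auto simp: T intro: measurable_compose[OF Ym borel_measurable_nth])
  moreover have "(\<Prod>q\<in>?J. indicator (T q) (Y (fst q) s $ snd q)) = (if \<forall>q\<in>?J. Y (fst q) s $ snd q \<in> T q then 1 else 0 :: real)" for s
  proof (cases "\<forall>q\<in>?J. Y (fst q) s $ snd q \<in> T q")
    case True
    then have "(\<Prod>q\<in>?J. indicator (T q) (Y (fst q) s $ snd q)) = (1 :: real)" by (intro prod.neutral) simp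
    then show ?thesis unfolding if_P[OF True] .
  next
    case False
    then have "\<exists>q\<in>?J. indicator (T q) (Y (fst q) s $ snd q) = (0 :: real)" by (auto simp: indicator_def)
    then have "(\<Prod>q\<in>?J. indicator (T q) (Y (fst q) s $ snd q)) = (0 :: real)" by (intro prod_zero) auto
    then show ?thesis unfolding if_not_P[OF False] .
  qed
  moreover define D where "D = {s\<in>G0. \<forall>q\<in>?J. Y (fst q) s $ snd q \<in> T q}"
  moreover have "W s * (if \<forall>q\<in>?J. Y (fst q) s $ snd q \<in> T q then 1 else 0)
      = indicator (D \<inter> (noise t f -` S \<inter> space M)) s - p * indicator D s" if "s \<in> space M" for s
    using that by (auto simp: W_def D_def split: split_indicator)
  ultimately have "(LINT s|M. indicator (D \<inter> (noise t f -` S \<inter> space M)) s - p * indicator D s) = 0"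
    by (simp cong: Bochner_Integration.integral_cong)
  moreover have D [measurable]: "D \<in> sets M"
    unfolding D_def by (rule sets_component_box[OF Ym G0M T])
  ultimately have "prob (D \<inter> (noise t f -` S \<inter> space M)) - p * prob D = 0"
  proof -
    have int: "integrable M (indicator X :: 'a \<Rightarrow> real)" if "X \<in> sets M" for X
      by (rule integrable_real_indicator[OF that]) (simp add: emeasure_eq_measure)
    have "D \<inter> (noise t f -` S \<inter> space M) \<in> sets M" by measurable
    with D show ?thesis
      using \<open>(LINT s|M. indicator (D \<inter> (noise t f -` S \<inter> space M)) s - p * indicator D s) = 0\<close>
      by (subst (asm) Bochner_Integration.integral_diff) (auto simp: int intro: sets.sets_into_space)
  qed
  then show ?thesis by (simp add: D_def p_def mult.commute)
qed

text \<open>Generated by quantities that no input enters. It will be shown to contain everything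
  observed up to time \<open>t\<close>.\<close>

definition centred_info :: "real^'n^'n \<Rightarrow> real^'n^'m \<Rightarrow> nat \<Rightarrow> 'a measure" where
  "centred_info A C t = sigma (space M)
    (sets G \<union> (\<Union>i\<le>t. rv_events M (\<lambda>s. C *v centred_state A X0 \<xi> i s + w i s)))"

text \<open>The boxes, an event of \<open>G\<close> cut by conditions on single output components,
  are stable under intersection and generate \<open>centred_info A C t\<close>. Independence
  therefore extends from them to the whole sigma-algebra.\<close>

lemma indep_orthogonal_noise:
  fixes A :: "real^'n^'n" and C :: "real^'n^'m"
  assumes orth: "\<And>d. cost t f (adjoint_traj A C 0 d) = 0"
    and D: "D \<in> sets (centred_info A C t)" and S: "S \<in> sets borel"
  shows "prob (D \<inter> (noise t f -` S \<inter> space M)) = prob D * prob (noise t f -` S \<inter> space M)"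
proof -
  define Y where "Y i s = C *v centred_state A X0 \<xi> i s + w i s" for i s
  let ?J = "{..t} \<times> (UNIV :: 'm set)"
  define box where "box G0 T = {s\<in>G0. \<forall>q\<in>?J. Y (fst q) s $ snd q \<in> T q}" for G0 T
  define \<D> where "\<D> = {box G0 T |G0 T. G0 \<in> sets G \<and> (\<forall>q. T q \<in> sets borel)}"
  define \<N> where "\<N> = {noise t f -` S \<inter> space M |S. S \<in> sets borel}"
  have GM: "sets G \<subseteq> sets M" and spG: "space G = space M" using subalgebra_G by (auto simp: subalgebra_def)
  have Ym [measurable]: "Y i \<in> borel_measurable M" for i
    unfolding Y_def[abs_def] using borel_measurable_centred_state[of X0 M \<xi> A i] by measurable
  have GS: "G0 \<subseteq> space M" if "G0 \<in> sets G" for G0 using sets.sets_into_space[OF that] spG by simp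
  have box_sets: "box G0 T \<in> sets M" if "G0 \<in> sets G" "\<And>q. T q \<in> sets borel" for G0 T
    unfolding box_def using GM that by (intro sets_component_box[OF Ym]) auto
  have "indep_set \<D> \<N>"
  proof (rule indep_setI)
    show "\<D> \<subseteq> events" using box_sets by (auto simp: \<D>_def)
    show "\<N> \<subseteq> events" by (auto simp: \<N>_def intro!: measurable_sets)
    fix a b assume "a \<in> \<D>" "b \<in> \<N>"
    then obtain G0 T S where "G0 \<in> sets G" "\<And>q. T q \<in> sets borel" "a = box G0 T" "S \<in> sets borel" "b = noise t f -` S \<inter> space M"
      unfolding \<D>_def \<N>_def by blast
    then show "prob (a \<inter> b) = prob a * prob b"
      unfolding box_def using indep_orthogonal_noise_box[OF orth Y_def] by simp
  qed
  moreover have "Int_stable \<D>"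
  proof (rule Int_stableI)
    fix a b assume "a \<in> \<D>" "b \<in> \<D>"
    then obtain G0 T G1 U where "G0 \<in> sets G" "\<And>q. T q \<in> sets borel" "a = box G0 T"
      "G1 \<in> sets G" "\<And>q. U q \<in> sets borel" "b = box G1 U"
      unfolding \<D>_def by blast
    moreover have "box G0 T \<inter> box G1 U = box (G0 \<inter> G1) (\<lambda>q. T q \<inter> U q)" by (auto simp: box_def)
    ultimately show "a \<inter> b \<in> \<D>" unfolding \<D>_def by (auto intro!: exI[of _ "G0 \<inter> G1"] exI[of _ "\<lambda>q. T q \<inter> U q"])
  qed
  moreover have "Int_stable \<N>"
  proof (rule Int_stableI)
    fix a b assume "a \<in> \<N>" "b \<in> \<N>"
    then obtain S T where "S \<in> sets borel" "T \<in> sets borel" "a = noise t f -` S \<inter> space M" "b = noise t f -` T \<inter> space M"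
      unfolding \<N>_def by blast
    then show "a \<inter> b \<in> \<N>" unfolding \<N>_def by (auto intro!: exI[of _ "S \<inter> T"])
  qed
  ultimately have ind: "indep_set (sigma_sets (space M) \<D>) (sigma_sets (space M) \<N>)"
    by (rule indep_set_sigma_sets)
  have \<D>_Pow: "\<D> \<subseteq> Pow (space M)" using GS by (auto simp: \<D>_def box_def)
  let ?N = "sigma (space M) \<D>"
  have Y_N: "Y i \<in> borel_measurable ?N" if i: "i \<le> t" for i
  proof (rule borel_measurable_vecI)
    fix l
    show "(\<lambda>s. Y i s $ l) \<in> borel_measurable ?N"
    proof (rule measurableI)
      fix T :: "real set" assume T: "T \<in> sets borel"
      \<comment> \<open>A condition on one component is the box with the full space as event of
        \<open>G\<close> and \<open>UNIV\<close> for all other components.\<close>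
      have "(\<lambda>s. Y i s $ l) -` T \<inter> space M = box (space M) (\<lambda>q. if q = (i, l) then T else UNIV)"
        using i by (auto simp: box_def split: if_splits)
      also have "\<dots> \<in> \<D>" unfolding \<D>_def using T sets.top[of G]
        by (intro CollectI exI conjI allI) (rule refl, simp_all add: spG)
      finally show "(\<lambda>s. Y i s $ l) -` T \<inter> space ?N \<in> sets ?N"
        using \<D>_Pow by (simp add: space_measure_of sets_measure_of)
    qed simp
  qed
  have "sets (centred_info A C t) \<subseteq> sigma_sets (space M) \<D>"
  proof -
    have "G0 \<in> sigma_sets (space M) \<D>" if "G0 \<in> sets G" for G0
    proof -
      have "box G0 (\<lambda>_. UNIV) \<in> \<D>"
        unfolding \<D>_def using that by (intro CollectI exI conjI allI) (rule refl, simp_all)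
      moreover have "box G0 (\<lambda>_. UNIV) = G0" by (simp add: box_def)
      ultimately show ?thesis by (simp add: sigma_sets.Basic)
    qed
    moreover have "rv_events M (Y i) \<subseteq> sigma_sets (space M) \<D>" if "i \<le> t" for i
      using measurable_sets[OF Y_N[OF that]] \<D>_Pow by (auto simp: rv_events_def space_measure_of sets_measure_of)
    ultimately have "sigma_sets (space M) (sets G \<union> (\<Union>i\<le>t. rv_events M (Y i))) \<subseteq> sigma_sets (space M) \<D>"
      by (intro sigma_sets_mono) auto
    moreover have "sets G \<union> (\<Union>i\<le>t. rv_events M (Y i)) \<subseteq> Pow (space M)"
      using GS by (auto simp: rv_events_def)
    ultimately show ?thesis by (simp add: centred_info_def Y_def[abs_def] sets_measure_of)
  qed
  moreover have "noise t f -` S \<inter> space M \<in> sigma_sets (space M) \<N>" using S by (auto simp: \<N>_def)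
  ultimately show ?thesis using D by (intro indep_setD[OF ind]) auto
qed

end

section \<open>The controlled system\<close>

lemma measurable_sigmaD:
  assumes "f \<in> measurable (sigma \<Omega> E) T" "E \<subseteq> sets N" "space N = \<Omega>"
  shows "f \<in> measurable N T"
proof -
  have "E \<subseteq> Pow \<Omega>" using assms(2,3) sets.sets_into_space[of _ N] by blast
  moreover have "sigma_sets \<Omega> E \<subseteq> sets N" using assms(2,3) by (metis sets.sigma_sets_subset)
  ultimately show ?thesis using assms(1,3) by (auto simp: measurable_def space_measure_of sets_measure_of)
qed

lemma rv_events_subset_iff:
  "space N = space M \<Longrightarrow> rv_events M f \<subseteq> sets N \<longleftrightarrow> f \<in> borel_measurable N"
  by (auto simp: rv_events_def measurable_def)

locale output_feedback_system = gaussian_noises M G "x 0" \<xi> w xhat0 \<Sigma>0 Q R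
  for M G :: "'a measure" and x \<xi> :: "nat \<Rightarrow> 'a \<Rightarrow> real^'n" and w :: "nat \<Rightarrow> 'a \<Rightarrow> real^'m"
    and xhat0 :: "real^'n" and \<Sigma>0 Q :: "real^'n^'n" and R :: "real^'m^'m" +
  fixes A :: "real^'n^'n" and B :: "real^'p^'n" and C :: "real^'n^'m"
    and y :: "nat \<Rightarrow> 'a \<Rightarrow> real^'m" and u :: "nat \<Rightarrow> 'a \<Rightarrow> real^'p"
  assumes state: "\<And>i s. s \<in> space M \<Longrightarrow> x (Suc i) s = A *v x i s + B *v u i s + \<xi> i s"
    and measurement: "\<And>i s. s \<in> space M \<Longrightarrow> y i s = C *v x i s + w i s"
    and causal: "causal_inputs M G y u"
begin

abbreviation "cstate \<equiv> centred_state A X0 \<xi>"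
abbreviation "F' t \<equiv> centred_info A C t"

lemma centred_info_generators:
  "sets G \<union> (\<Union>i\<le>t. rv_events M (\<lambda>s. C *v cstate i s + w i s)) \<subseteq> sets M"
proof -
  have "(\<lambda>s. C *v cstate i s + w i s) \<in> borel_measurable M" for i
    using borel_measurable_centred_state[of X0 M \<xi> A i] by measurable
  then have "rv_events M (\<lambda>s. C *v cstate i s + w i s) \<subseteq> sets M" for i
    by (simp add: rv_events_subset_iff)
  then show ?thesis using subalgebra_G by (auto simp: subalgebra_def)
qed

lemma space_F' [simp]: "space (F' t) = space M"
  and sets_F'_subset: "sets (F' t) \<subseteq> sets M"
  and generators_F': "sets G \<union> (\<Union>i\<le>t. rv_events M (\<lambda>s. C *v cstate i s + w i s)) \<subseteq> sets (F' t)"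
proof -
  have P: "sets G \<union> (\<Union>i\<le>t. rv_events M (\<lambda>s. C *v cstate i s + w i s)) \<subseteq> Pow (space M)"
    using centred_info_generators[of t] sets.space_closed[of M] by blast
  then show "space (F' t) = space M" by (simp add: centred_info_def space_measure_of)
  show "sets (F' t) \<subseteq> sets M"
    using sets.sigma_sets_subset[OF centred_info_generators] P by (simp add: centred_info_def sets_measure_of)
  show "sets G \<union> (\<Union>i\<le>t. rv_events M (\<lambda>s. C *v cstate i s + w i s)) \<subseteq> sets (F' t)"
    using P by (auto simp: centred_info_def sets_measure_of)
qed

lemma measurable_input:
  assumes "i \<le> t" "\<And>j. j \<le> i \<Longrightarrow> y j \<in> borel_measurable (F' t)"
  shows "u i \<in> borel_measurable (F' t)"
proof -
  have "u i \<in> borel_measurable (sigma (space M) (sets G \<union> (\<Union>j\<in>{..i}. rv_events M (y j))))"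
    using causal by (simp add: causal_inputs_def)
  moreover have "sets G \<union> (\<Union>j\<in>{..i}. rv_events M (y j)) \<subseteq> sets (F' t)"
  proof -
    have "rv_events M (y j) \<subseteq> sets (F' t)" if "j \<le> i" for j
      using assms(2)[OF that] by (simp add: rv_events_subset_iff)
    then show ?thesis using generators_F'[of t] by auto
  qed
  ultimately show ?thesis by (rule measurable_sigmaD) simp
qed

text \<open>The difference starts at the constant \<open>xhat0\<close> and obeys the noise-free
  dynamics driven by the inputs, while \<open>y i\<close> is the centred output plus
  \<open>C\<close> applied to the difference. Inputs depend on earlier outputs and outputs on
  earlier inputs, hence one induction for both.\<close>

lemma measurable_state_diff:
  assumes "i \<le> t"
  shows "(\<lambda>s. x i s - cstate i s) \<in> borel_measurable (F' t) \<and> (\<forall>j\<le>i. y j \<in> borel_measurable (F' t))"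
  using assms
proof (induction i)
  have y: "y i \<in> borel_measurable (F' t)" if i: "i \<le> t" and [measurable]: "(\<lambda>s. x i s - cstate i s) \<in> borel_measurable (F' t)" for i
  proof -
    have "rv_events M (\<lambda>s. C *v cstate i s + w i s) \<subseteq> sets (F' t)" using generators_F'[of t] i by auto
    then have [measurable]: "(\<lambda>s. C *v cstate i s + w i s) \<in> borel_measurable (F' t)"
      by (subst (asm) rv_events_subset_iff) simp_all
    have "(\<lambda>s. (C *v cstate i s + w i s) + C *v (x i s - cstate i s)) \<in> borel_measurable (F' t)" by measurable
    then show ?thesis
      by (rule measurable_cong[THEN iffD1, rotated]) (simp add: measurement matrix_vector_mult_diff_distrib)
  qed
  {
    case 0
    have "(\<lambda>s. x 0 s - cstate 0 s) \<in> borel_measurable (F' t)" by simp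
    then show ?case using y[of 0] by simp
  next
    case (Suc i)
    then have [measurable]: "(\<lambda>s. x i s - cstate i s) \<in> borel_measurable (F' t)"
      and yi: "\<And>j. j \<le> i \<Longrightarrow> y j \<in> borel_measurable (F' t)" by auto
    have [measurable]: "u i \<in> borel_measurable (F' t)" using Suc.prems yi by (intro measurable_input) auto
    have "(\<lambda>s. A *v (x i s - cstate i s) + B *v u i s) \<in> borel_measurable (F' t)" by measurable
    then have "(\<lambda>s. x (Suc i) s - cstate (Suc i) s) \<in> borel_measurable (F' t)"
      by (rule measurable_cong[THEN iffD1, rotated]) (simp add: state matrix_vector_mult_diff_distrib)
    then show ?case using y[OF Suc.prems] yi by (auto simp: le_Suc_eq)
  }
qed

lemma measurable_y_F': "i \<le> t \<Longrightarrow> y i \<in> borel_measurable (F' t)"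
  and measurable_u_F': "i \<le> t \<Longrightarrow> u i \<in> borel_measurable (F' t)"
  using measurable_state_diff[of i t] by (auto intro: measurable_input)

lemma measurable_x: "x i \<in> borel_measurable M"
proof -
  have "(\<lambda>s. x i s - cstate i s) \<in> borel_measurable M"
    using measurable_state_diff[of i i] measurable_from_subalg[of M "F' i"] sets_F'_subset[of i]
    by (auto simp: subalgebra_def)
  moreover have "cstate i \<in> borel_measurable M"
    by (rule borel_measurable_centred_state) measurable
  ultimately have "(\<lambda>s. (x i s - cstate i s) + cstate i s) \<in> borel_measurable M" by measurable
  then show ?thesis by simp
qed

lemma info_generators: "(\<Union>i\<in>{..t}. rv_events M (y i)) \<union> (\<Union>i\<in>{..<t}. rv_events M (u i)) \<subseteq> sets (F' t)"
proof -
  have "rv_events M (y i) \<subseteq> sets (F' t)" if "i \<le> t" for i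
    using measurable_y_F'[OF that] by (simp add: rv_events_subset_iff)
  moreover have "rv_events M (u i) \<subseteq> sets (F' t)" if "i < t" for i
    using measurable_u_F'[of i t] that by (simp add: rv_events_subset_iff)
  ultimately show ?thesis by auto
qed

lemma space_info [simp]: "space (info_algebra M y u t) = space M"
  and sets_info_subset: "sets (info_algebra M y u t) \<subseteq> sets (F' t)"
  and measurable_y_info: "i \<le> t \<Longrightarrow> y i \<in> borel_measurable (info_algebra M y u t)"
  and measurable_u_info: "i < t \<Longrightarrow> u i \<in> borel_measurable (info_algebra M y u t)"
proof -
  have P: "(\<Union>i\<in>{..t}. rv_events M (y i)) \<union> (\<Union>i\<in>{..<t}. rv_events M (u i)) \<subseteq> Pow (space M)"
    using order_trans[OF info_generators[of t] sets.space_closed] by simp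
  show sp: "space (info_algebra M y u t) = space M"
    using P unfolding info_algebra_def by (rule space_measure_of)
  have S: "sets (info_algebra M y u t) = sigma_sets (space M) ((\<Union>i\<in>{..t}. rv_events M (y i)) \<union> (\<Union>i\<in>{..<t}. rv_events M (u i)))"
    using P unfolding info_algebra_def by (rule sets_measure_of)
  show "sets (info_algebra M y u t) \<subseteq> sets (F' t)"
    using sets.sigma_sets_subset[OF info_generators] by (simp add: S)
  show "y i \<in> borel_measurable (info_algebra M y u t)" if "i \<le> t"
    using that S by (subst rv_events_subset_iff[OF sp, symmetric]) auto
  show "u i \<in> borel_measurable (info_algebra M y u t)" if "i < t"
    using that S by (subst rv_events_subset_iff[OF sp, symmetric]) auto
qed

lemma subalgebra_info: "subalgebra M (info_algebra M y u t)"
  using sets_info_subset[of t] sets_F'_subset[of t] by (auto simp: subalgebra_def)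

definition dual_estimator :: "nat \<Rightarrow> (nat \<Rightarrow> real^'q^'n) \<Rightarrow> (nat \<Rightarrow> real^'q^'m) \<Rightarrow> 'a \<Rightarrow> real^'q" where
  "dual_estimator t z \<alpha> s = transpose (z t) *v xhat0
    + (\<Sum>i<t. transpose (z i) *v (B *v u (t - i - 1) s))
    - (\<Sum>i\<le>t. transpose (\<alpha> i) *v y (t - i) s)"

text \<open>Only \<open>K\<close> and \<open>\<alpha>\<close> appear, since feasibility determines
  \<open>z\<close> up to time \<open>t\<close>.\<close>

definition dual_error :: "real^'n^'q \<Rightarrow> nat \<Rightarrow> (nat \<Rightarrow> real^'q^'m) \<Rightarrow> 'a \<Rightarrow> real^'q" where
  "dual_error K t \<alpha> s = (\<chi> j. noise t (adjoint_traj A C (row j K) (\<lambda>i. column j (\<alpha> i))) s)"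

lemma transpose_mult_nth: "(transpose Z *v v) $ j = column j Z \<bullet> v"
  by (simp add: matrix_vector_mult_def transpose_def column_def inner_vec_def)

text \<open>Telescoping with \<open>B *v u i s + \<xi> i s\<close> as driving term and each row of
  \<open>K\<close> as \<open>k\<close>. The input and measurement terms and \<open>xhat0\<close> are
  collected in the estimator; the noises and the centred initial state form the error.\<close>

lemma target_decomposition:
  assumes feas: "dual_feasible A C K t z \<alpha>" and s: "s \<in> space M"
  shows "K *v x t s = dual_estimator t z \<alpha> s + dual_error K t \<alpha> s"
proof (rule vec_eq_iff[THEN iffD2], rule)
  fix j
  let ?a = "\<lambda>i. column j (\<alpha> i)"
  have z: "adjoint_state A C (row j K) ?a i = column j (z i)" if "i \<le> t" for i
    using feas that by (simp add: dual_feasible_iff)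
  have "x (Suc i) s = A *v x i s + (B *v u i s + \<xi> i s)" for i
    using state[OF s] by (simp add: add.assoc)
  from adjoint_telescope[of "\<lambda>i. x i s" A "\<lambda>i. B *v u i s + \<xi> i s" "\<lambda>i. y i s" C "\<lambda>i. w i s", OF this measurement[OF s] order_refl, of "row j K" t ?a]
  have "row j K \<bullet> x t s = column j (z t) \<bullet> x 0 s
      + (\<Sum>i<t. column j (z i) \<bullet> (B *v u (t - Suc i) s + \<xi> (t - Suc i) s)) + (\<Sum>i\<le>t. ?a i \<bullet> (w (t - i) s - y (t - i) s))"
    by (simp add: z)
  moreover have "(K *v x t s) $ j = row j K \<bullet> x t s" by (simp add: matrix_vector_mul_component row_def)
  ultimately show "(K *v x t s) $ j = (dual_estimator t z \<alpha> s + dual_error K t \<alpha> s) $ j"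
    by (simp add: dual_estimator_def dual_error_def noise_combination_def adjoint_traj_def
        z transpose_mult_nth inner_add_right inner_diff_right sum.distrib sum_subtractf del: transpose_matrix_vector)
qed

lemma measurable_dual_estimator: "dual_estimator t z \<alpha> \<in> borel_measurable (info_algebra M y u t)"
proof -
  have [measurable]: "(\<lambda>s. transpose (z i) *v (B *v u (t - i - 1) s)) \<in> borel_measurable (info_algebra M y u t)" if "i < t" for i
  proof -
    have [measurable]: "u (t - i - 1) \<in> borel_measurable (info_algebra M y u t)"
      by (rule measurable_u_info) (use that in simp)
    show ?thesis by measurable
  qed
  have [measurable]: "(\<lambda>s. transpose (\<alpha> i) *v y (t - i) s) \<in> borel_measurable (info_algebra M y u t)" for i
    using measurable_y_info[of "t - i" t] by measurable
  show ?thesis unfolding dual_estimator_def[abs_def] by measurable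
qed

lemma dual_error_indep:
  assumes sol: "dual_solution A C K \<Sigma>0 Q R t z \<alpha>"
    and "D \<in> sets (info_algebra M y u t)" "S \<in> sets borel"
  shows "prob (D \<inter> ((\<lambda>s. dual_error K t \<alpha> s $ j) -` S \<inter> space M)) = prob D * prob ((\<lambda>s. dual_error K t \<alpha> s $ j) -` S \<inter> space M)"
  using indep_orthogonal_noise[of t "adjoint_traj A C (row j K) (\<lambda>i. column j (\<alpha> i))" A C D S] assms sets_info_subset[of t]
  by (auto simp: dual_error_def dual_solution_iff[OF psd_covariances])

lemma dual_error_moments:
  "integrable M (\<lambda>s. dual_error K t \<alpha> s $ j)" "expectation (\<lambda>s. dual_error K t \<alpha> s $ j) = 0"
  "integrable M (\<lambda>s. (dual_error K t \<alpha> s $ j)\<^sup>2)"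
  "expectation (\<lambda>s. (dual_error K t \<alpha> s $ j)\<^sup>2) = column_cost A C K \<Sigma>0 Q R t j (\<lambda>i. column j (\<alpha> i))"
  by (simp_all add: dual_error_def noise_moments column_cost_def)

text \<open>A conditional Pythagoras identity: the difference of target and \<open>v\<close> is an
  observable part plus the dual error, which has mean zero and is independent of the observations,
  so it contributes its unconditional mean square.\<close>

lemma cond_mse_eq:
  fixes K :: "real^'n^'p"
  assumes sol: "dual_solution A C K \<Sigma>0 Q R t z \<alpha>" and v: "v \<in> borel_measurable (info_algebra M y u t)"
  shows "AE s in M. cond_mse M (info_algebra M y u t) (\<lambda>s. K *v x t s) v s
    = ennreal ((norm (dual_estimator t z \<alpha> s - v s))\<^sup>2 + dual_value A C K \<Sigma>0 Q R t)"
proof -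
  let ?F = "info_algebra M y u t"
  let ?g = "\<lambda>s. dual_estimator t z \<alpha> s - v s"
  interpret finite_measure_subalgebra M ?F by unfold_locales (rule subalgebra_info)
  have feas: "dual_feasible A C K t z \<alpha>" using sol by (simp add: dual_solution_def)
  have g: "?g \<in> borel_measurable ?F" using v measurable_dual_estimator[of t z \<alpha>] by measurable
  note [measurable] = measurable_x measurable_from_subalg[OF subalgebra_info v]
    measurable_from_subalg[OF subalgebra_info measurable_dual_estimator]
  have [measurable]: "dual_error K t \<alpha> \<in> borel_measurable M"
    by (rule borel_measurable_vecI) (simp add: dual_error_def)
  have "AE s in M. cond_mse M ?F (\<lambda>s. K *v x t s) v s = nn_cond_exp M ?F (\<lambda>s. ennreal ((norm (?g s + dual_error K t \<alpha> s))\<^sup>2)) s"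
    unfolding cond_mse_def
    by (rule nn_cond_exp_cong) (auto intro!: AE_I2 simp: target_decomposition[OF feas] algebra_simps)
  moreover have "AE s in M. nn_cond_exp M ?F (\<lambda>s. ennreal ((norm (?g s + dual_error K t \<alpha> s))\<^sup>2)) s
      = ennreal ((norm (?g s))\<^sup>2 + (\<Sum>j\<in>UNIV. column_cost A C K \<Sigma>0 Q R t j (\<lambda>i. column j (\<alpha> i))))"
    by (rule nn_cond_exp_norm_add_indep[OF subalgebra_info dual_error_indep[OF sol] g dual_error_moments])
  moreover have "(\<Sum>j\<in>UNIV. column_cost A C K \<Sigma>0 Q R t j (\<lambda>i. column j (\<alpha> i))) = dual_value A C K \<Sigma>0 Q R t"
    by (simp add: dual_value_eq[OF sol] dual_cost_feasible[OF feas])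
  ultimately show ?thesis by (auto elim!: AE_mp)
qed

text \<open>In each coordinate the target is an observable function plus an independent centred
  error.\<close>

lemma vec_cond_exp_eq:
  fixes K :: "real^'n^'p"
  assumes sol: "dual_solution A C K \<Sigma>0 Q R t z \<alpha>"
  shows "AE s in M. vec_cond_exp M (info_algebra M y u t) (\<lambda>s. K *v x t s) s = dual_estimator t z \<alpha> s"
proof -
  let ?F = "info_algebra M y u t"
  interpret finite_measure_subalgebra M ?F by unfold_locales (rule subalgebra_info)
  have feas: "dual_feasible A C K t z \<alpha>" using sol by (simp add: dual_solution_def)
  have [measurable]: "(\<lambda>s. (K *v x t s) $ j) \<in> borel_measurable M" for j
    by (intro measurable_compose[OF _ borel_measurable_nth] borel_measurable_matrix_vector_mult measurable_x)
  have L: "(\<lambda>s. dual_estimator t z \<alpha> s $ j) \<in> borel_measurable ?F" for j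
    by (rule measurable_compose[OF measurable_dual_estimator borel_measurable_nth])
  have "AE s in M. real_cond_exp M ?F (\<lambda>s. (K *v x t s) $ j) s = dual_estimator t z \<alpha> s $ j" for j
  proof -
    note [measurable] = measurable_from_subalg[OF subalgebra_info L[of j]]
      borel_measurable_integrable[OF dual_error_moments(1)[of K t \<alpha> j]]
    have "AE s in M. real_cond_exp M ?F (\<lambda>s. (K *v x t s) $ j) s
        = real_cond_exp M ?F (\<lambda>s. dual_estimator t z \<alpha> s $ j + dual_error K t \<alpha> s $ j) s"
      by (rule real_cond_exp_cong) (auto intro!: AE_I2 simp: target_decomposition[OF feas])
    moreover have "AE s in M. real_cond_exp M ?F (\<lambda>s. dual_estimator t z \<alpha> s $ j + dual_error K t \<alpha> s $ j) s
        = dual_estimator t z \<alpha> s $ j"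
      by (rule real_cond_exp_add_indep[OF subalgebra_info dual_error_indep[OF sol] L dual_error_moments(1,2)])
    ultimately show ?thesis by eventually_elim simp
  qed
  then have "AE s in M. \<forall>j\<in>UNIV. real_cond_exp M ?F (\<lambda>s. (K *v x t s) $ j) s = dual_estimator t z \<alpha> s $ j"
    by (intro AE_finite_allI) auto
  then show ?thesis by eventually_elim (simp add: vec_cond_exp_def vec_eq_iff)
qed

end

theorem theorem1:
  fixes M G :: "'a measure"
    and A :: "real^'n^'n" and B :: "real^'p^'n" and C :: "real^'n^'m"
    and Q \<Sigma>0 Qc Pc :: "real^'n^'n" and R :: "real^'m^'m" and Rc :: "real^'p^'p"
    and K :: "real^'n^'p" and xhat0 :: "real^'n"
    and x \<xi> :: "nat \<Rightarrow> 'a \<Rightarrow> real^'n" and y w :: "nat \<Rightarrow> 'a \<Rightarrow> real^'m"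
    and u :: "nat \<Rightarrow> 'a \<Rightarrow> real^'p" and t :: nat
  assumes "prob_space M"
    and "CARD('m) < CARD('n)"
    and "\<And>i s. s \<in> space M \<Longrightarrow> x (Suc i) s = A *v x i s + B *v u i s + \<xi> i s"
    and "\<And>i s. s \<in> space M \<Longrightarrow> y i s = C *v x i s + w i s"
    and "gaussian_vector M (x 0) xhat0 \<Sigma>0"
    and "\<And>i. gaussian_vector M (\<xi> i) 0 Q"
    and "\<And>i. gaussian_vector M (w i) 0 R"
    and "subalgebra M G"
    and "prob_space.indep_sets M (source_events M (x 0) \<xi> w G) UNIV"
    and "causal_inputs M G y u"
    and "psd Qc" and "pd Rc"
    and "stabilizable A B" and "detectable A (psd_sqrt Qc)"
    and "psd Pc" and "dare A B Qc Rc Pc"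
    and "K = lqg_gain A B Rc Pc"
  shows
    "let F = info_algebra M y u t;
         target = (\<lambda>s. K *v x t s);
         uhat = vec_cond_exp M F target
     in mmse_minimizer M F target uhat
      \<and> (\<forall>v. mmse_minimizer M F target v \<longrightarrow>
           (AE s in M. v s = uhat s) \<and>
           (AE s in M. cond_mse M F target v s = ennreal (dual_value A C K \<Sigma>0 Q R t)))
      \<and> (\<exists>z \<alpha>. dual_solution A C K \<Sigma>0 Q R t z \<alpha>)
      \<and> (\<forall>z \<alpha>. dual_solution A C K \<Sigma>0 Q R t z \<alpha> \<longrightarrow>
           (AE s in M. uhat s =
              transpose (z t) *v xhat0
              + (\<Sum>i<t. transpose (z i) *v (B *v u (t - i - 1) s))
              - (\<Sum>i\<le>t. transpose (\<alpha> i) *v y (t - i) s)))"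
proof -
  interpret prob_space M by fact
  interpret output_feedback_system M G x \<xi> w xhat0 \<Sigma>0 Q R A B C y u
    by unfold_locales (use assms in auto)
  define F where "F = info_algebra M y u t"
  define target where "target = (\<lambda>s. K *v x t s)"
  define uhat where "uhat = vec_cond_exp M F target"
  let ?V = "dual_value A C K \<Sigma>0 Q R t"
  \<comment> \<open>Dual minimisers may fail to be unique for singular covariances. One of them
    anchors the argument, and \<open>uhat_eq\<close> below holds for each.\<close>
  obtain z \<alpha> where sol: "dual_solution A C K \<Sigma>0 Q R t z \<alpha>"
    using ex_dual_solution[OF psd_covariances] by blast
  have V0: "0 \<le> ?V"
    using sol by (simp add: dual_value_eq[OF sol] dual_cost_eq sum_nonneg cost_form_nonneg[OF psd_covariances])
  have uhat_eq: "AE s in M. uhat s = dual_estimator t z \<alpha> s"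
    if "dual_solution A C K \<Sigma>0 Q R t z \<alpha>" for z \<alpha>
    unfolding uhat_def F_def target_def by (rule vec_cond_exp_eq[OF that])
  \<comment> \<open>With \<open>uhat\<close> in place of the dual estimator, this single identity
    yields minimality, uniqueness and the optimal value.\<close>
  have mse: "AE s in M. cond_mse M F target v s = ennreal ((norm (uhat s - v s))\<^sup>2 + ?V)"
    if v: "v \<in> borel_measurable F" for v
    using uhat_eq[OF sol] cond_mse_eq[OF sol v[unfolded F_def]] unfolding F_def target_def
    by eventually_elim simp
  have uhat_meas: "uhat \<in> borel_measurable F"
    unfolding uhat_def by (rule borel_measurable_vecI) (simp add: vec_cond_exp_def)
  have "mmse_minimizer M F target uhat"
    unfolding mmse_minimizer_def
  proof (intro conjI ballI uhat_meas)
    fix v' :: "'a \<Rightarrow> real^'p" assume "v' \<in> borel_measurable F"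
    from mse[OF this] mse[OF uhat_meas]
    show "AE s in M. cond_mse M F target uhat s \<le> cond_mse M F target v' s"
      by eventually_elim (simp add: ennreal_leI)
  qed
  moreover have "(AE s in M. v s = uhat s) \<and> (AE s in M. cond_mse M F target v s = ennreal ?V)"
    if "mmse_minimizer M F target v" for v
  proof -
    have v: "v \<in> borel_measurable F" and le: "AE s in M. cond_mse M F target v s \<le> cond_mse M F target uhat s"
      using that uhat_meas by (auto simp: mmse_minimizer_def)
    have eq: "AE s in M. v s = uhat s"
      using le mse[OF v] mse[OF uhat_meas]
    proof eventually_elim
      case (elim s)
      \<comment> \<open>The common value is finite and non-negative, so it cancels and forces the
        squared distance to be zero.\<close>
      then have "ennreal ((norm (uhat s - v s))\<^sup>2 + ?V) \<le> ennreal ?V" by simp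
      then have "(norm (uhat s - v s))\<^sup>2 \<le> 0" using V0 by (subst (asm) ennreal_le_iff) simp_all
      then show ?case by simp
    qed
    moreover have "AE s in M. cond_mse M F target v s = ennreal ?V"
      using eq mse[OF v] by eventually_elim simp
    ultimately show ?thesis by blast
  qed
  moreover have "AE s in M. uhat s = transpose (z t) *v xhat0
      + (\<Sum>i<t. transpose (z i) *v (B *v u (t - i - 1) s)) - (\<Sum>i\<le>t. transpose (\<alpha> i) *v y (t - i) s)"
    if "dual_solution A C K \<Sigma>0 Q R t z \<alpha>" for z \<alpha>
    using uhat_eq[OF that] by (simp add: dual_estimator_def)
  ultimately show ?thesis
    using sol unfolding Let_def F_def[symmetric] target_def[symmetric] uhat_def[symmetric] by blast
qed

end
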